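(* Let $(X_1, X_2, X_3)$ be an $\mathbb{E}$-contraction consisting of normal operators on a complex Hilbert space. Then its fundamental operators $F_1, F_2$ are commuting normal operators and $\sup_{z\in\overline{\mathbb{D}}}\|F_1^*+F_2z\|\le 1$.
   Context: All operators are bounded linear maps on complex Hilbert spaces; $\mathbb{D}$ is the open unit disc in $\mathbb{C}$. The tetrablock is $\mathbb{E}=\{(x_1,x_2,x_3)\in\mathbb{C}^3 : 1-x_1z_1-x_2z_2+x_3z_1z_2\neq 0 \text{ whenever } |z_1|\le 1, |z_2|\le 1\}$; its closure is polynomially convex. A commuting triple $(X_1,X_2,X_3)$ is an $\mathbb{E}$-contraction if $\|p(X_1,X_2,X_3)\|\le\sup_{\overline{\mathbb{E}}}|p|$ for every $p\in\mathbb{C}[z_1,z_2,z_3]$; in particular $\|X_3\|\le1$. For a contraction $T$, $D_T=(I-T^*T)^{1/2}$ and $\mathcal{D}_T=\overline{\operatorname{Ran}}\,D_T$. For an $\mathbb{E}$-contraction $(X_1,X_2,X_3)$, the equations $X_1-X_2^*X_3=D_{X_3}F_1D_{X_3}$ and $X_2-X_1^*X_3=D_{X_3}F_2D_{X_3}$ have unique solutions $F_1,F_2\in\mathcal{B}(\mathcal{D}_{X_3})$ (a known fact), called the fundamental operators of $(X_1,X_2,X_3)$. *)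

theory Defs
  imports "HOL-Analysis.Analysis" "HOL-Library.Poly_Mapping"
begin

section \<open>Complex Hilbert spaces\<close>

text \<open>The inner product is linear in the first argument. The last axiom makes it positive definite
  and makes the given complete norm the one it induces.\<close>

class chilbert_space = banach +
  fixes scaleC :: "complex \<Rightarrow> 'a \<Rightarrow> 'a" (infixr \<open>*\<^sub>C\<close> 75)
    and cinner :: "'a \<Rightarrow> 'a \<Rightarrow> complex"
  assumes scaleC_add_right: "a *\<^sub>C (x + y) = a *\<^sub>C x + a *\<^sub>C y"
    and scaleC_add_left: "(a + b) *\<^sub>C x = a *\<^sub>C x + b *\<^sub>C x"
    and scaleC_scaleC: "a *\<^sub>C b *\<^sub>C x = (a * b) *\<^sub>C x"
    and scaleR_scaleC: "r *\<^sub>R x = complex_of_real r *\<^sub>C x"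
    and cinner_commute: "cinner x y = cnj (cinner y x)"
    and cinner_add_left: "cinner (x + y) z = cinner x z + cinner y z"
    and cinner_scaleC_left: "cinner (a *\<^sub>C x) y = a * cinner x y"
    and cinner_self: "cinner x x = complex_of_real ((norm x)\<^sup>2)"

instantiation complex :: chilbert_space
begin

definition scaleC_complex :: "complex \<Rightarrow> complex \<Rightarrow> complex"
  where "scaleC_complex a x = a * x"

definition cinner_complex :: "complex \<Rightarrow> complex \<Rightarrow> complex"
  where "cinner_complex x y = x * cnj y"

instance
  by standard
    (simp_all add: scaleC_complex_def cinner_complex_def algebra_simps scaleR_conv_of_real
      complex_norm_square del: of_real_power)

end


section \<open>Bounded operators\<close>

text \<open>The operators \<open>F\<^sub>1\<close>, \<open>F\<^sub>2\<close> act on a closed subspace that depends on the given operators, so it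
  cannot be a type. The notions below are therefore relative to a closed complex subspace \<open>S\<close>, seen as
  a Hilbert space in its own right; an operator on \<open>S\<close> is a function whose values outside \<open>S\<close> are
  irrelevant. The whole space is \<open>S = UNIV\<close>.\<close>

definition bounded_op_on :: "'a::chilbert_space set \<Rightarrow> ('a \<Rightarrow> 'a) \<Rightarrow> bool"
  where "bounded_op_on S T \<longleftrightarrow>
    (\<forall>x\<in>S. T x \<in> S) \<and>
    (\<forall>x\<in>S. \<forall>y\<in>S. T (x + y) = T x + T y) \<and>
    (\<forall>c. \<forall>x\<in>S. T (c *\<^sub>C x) = c *\<^sub>C T x) \<and>
    (\<exists>K. \<forall>x\<in>S. norm (T x) \<le> K * norm x)"

definition opnorm_on :: "'a::chilbert_space set \<Rightarrow> ('a \<Rightarrow> 'a) \<Rightarrow> real"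
  where "opnorm_on S T = (SUP x\<in>{x\<in>S. norm x \<le> 1}. norm (T x))"

definition adjoint_on :: "'a::chilbert_space set \<Rightarrow> ('a \<Rightarrow> 'a) \<Rightarrow> 'a \<Rightarrow> 'a"
  where "adjoint_on S T y = (THE z. z \<in> S \<and> (\<forall>x\<in>S. cinner (T x) y = cinner x z))"

definition normal_on :: "'a::chilbert_space set \<Rightarrow> ('a \<Rightarrow> 'a) \<Rightarrow> bool"
  where "normal_on S T \<longleftrightarrow> bounded_op_on S T \<and>
    (\<forall>x\<in>S. adjoint_on S T (T x) = T (adjoint_on S T x))"

definition commute_on :: "'a set \<Rightarrow> ('a \<Rightarrow> 'a) \<Rightarrow> ('a \<Rightarrow> 'a) \<Rightarrow> bool"
  where "commute_on S A B \<longleftrightarrow> (\<forall>x\<in>S. A (B x) = B (A x))"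

definition positive_op :: "('a::chilbert_space \<Rightarrow> 'a) \<Rightarrow> bool"
  where "positive_op A \<longleftrightarrow> bounded_op_on UNIV A \<and> (\<forall>x. cinner (A x) x \<in> \<real>\<^sub>\<ge>\<^sub>0)"

definition op_sqrt :: "('a::chilbert_space \<Rightarrow> 'a) \<Rightarrow> 'a \<Rightarrow> 'a"
  where "op_sqrt A = (THE B. positive_op B \<and> (\<forall>x. B (B x) = A x))"

definition defect_op :: "('a::chilbert_space \<Rightarrow> 'a) \<Rightarrow> 'a \<Rightarrow> 'a"
  where "defect_op T = op_sqrt (\<lambda>x. x - adjoint_on UNIV T (T x))"

definition defect_space :: "('a::chilbert_space \<Rightarrow> 'a) \<Rightarrow> 'a set"
  where "defect_space T = closure (range (defect_op T))"


section \<open>The tetrablock and its contractions\<close>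

definition tetrablock :: "(complex \<times> complex \<times> complex) set"
  where "tetrablock = {(x1, x2, x3). \<forall>z1 z2. cmod z1 \<le> 1 \<longrightarrow> cmod z2 \<le> 1 \<longrightarrow>
    1 - x1 * z1 - x2 * z2 + x3 * z1 * z2 \<noteq> 0}"

text \<open>A polynomial in three variables is a finitely supported family of coefficients indexed by the
  exponents \<open>(i, j, k)\<close>.\<close>

type_synonym poly3 = "(nat \<times> nat \<times> nat) \<Rightarrow>\<^sub>0 complex"

definition poly3_eval :: "poly3 \<Rightarrow> complex \<times> complex \<times> complex \<Rightarrow> complex"
  where "poly3_eval p = (\<lambda>(x1, x2, x3).
    \<Sum>(i, j, k)\<in>Poly_Mapping.keys p. Poly_Mapping.lookup p (i, j, k) * x1 ^ i * x2 ^ j * x3 ^ k)"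

definition poly3_op ::
  "poly3 \<Rightarrow> ('a::chilbert_space \<Rightarrow> 'a) \<Rightarrow> ('a \<Rightarrow> 'a) \<Rightarrow> ('a \<Rightarrow> 'a) \<Rightarrow> 'a \<Rightarrow> 'a"
  where "poly3_op p X1 X2 X3 x =
    (\<Sum>(i, j, k)\<in>Poly_Mapping.keys p.
      Poly_Mapping.lookup p (i, j, k) *\<^sub>C (X1 ^^ i) ((X2 ^^ j) ((X3 ^^ k) x)))"

definition tetrablock_contraction ::
  "('a::chilbert_space \<Rightarrow> 'a) \<Rightarrow> ('a \<Rightarrow> 'a) \<Rightarrow> ('a \<Rightarrow> 'a) \<Rightarrow> bool"
  where "tetrablock_contraction X1 X2 X3 \<longleftrightarrow>
    bounded_op_on UNIV X1 \<and> bounded_op_on UNIV X2 \<and> bounded_op_on UNIV X3 \<and>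
    commute_on UNIV X1 X2 \<and> commute_on UNIV X1 X3 \<and> commute_on UNIV X2 X3 \<and>
    (\<forall>p. opnorm_on UNIV (poly3_op p X1 X2 X3)
          \<le> (SUP z\<in>closure tetrablock. cmod (poly3_eval p z)))"

definition fundamental_operators ::
  "('a::chilbert_space \<Rightarrow> 'a) \<Rightarrow> ('a \<Rightarrow> 'a) \<Rightarrow> ('a \<Rightarrow> 'a) \<Rightarrow> ('a \<Rightarrow> 'a) \<Rightarrow> ('a \<Rightarrow> 'a) \<Rightarrow> bool"
  where "fundamental_operators X1 X2 X3 F1 F2 \<longleftrightarrow>
    bounded_op_on (defect_space X3) F1 \<and> bounded_op_on (defect_space X3) F2 \<and>
    (\<forall>x. X1 x - adjoint_on UNIV X2 (X3 x) = defect_op X3 (F1 (defect_op X3 x))) \<and>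
    (\<forall>x. X2 x - adjoint_on UNIV X1 (X3 x) = defect_op X3 (F2 (defect_op X3 x)))"

end

theory Submission
  imports "HOL-Complex_Analysis.Cauchy_Integral_Formula" Defs
begin

text \<open>Write \<open>D\<close> for the defect operator of \<open>X\<^sub>3\<close> and \<open>S\<close> for the closure of its range. The defining equations
of the fundamental operators say \<open>D F\<^sub>i D = B\<^sub>i\<close> with \<open>B\<^sub>1 = X\<^sub>1 - X\<^sub>2\<^sup>* X\<^sub>3\<close> and \<open>B\<^sub>2 = X\<^sub>2 - X\<^sub>1\<^sup>* X\<^sub>3\<close>.

\<^bold>\<open>Algebra.\<close> Fuglede's theorem makes the three normal operators commute with each other's adjoints, so
the \<open>B\<^sub>i\<close>, their adjoints and \<open>D\<close> form a commuting family (\<open>D\<close> is a limit of polynomials in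
\<open>X\<^sub>3\<^sup>* X\<^sub>3\<close>). Since \<open>D\<close> is injective on \<open>S\<close> with dense range there, each relation between the \<open>B\<^sub>i\<close> and
their adjoints can be divided by powers of \<open>D\<close> and becomes the same relation between the \<open>F\<^sub>i\<close> and
their adjoints (\<open>sandwich_commute\<close>). This gives commutation and normality.

\<^bold>\<open>Norm bound.\<close> For \<open>|z| < 1\<close> the function \<open>(x\<^sub>1 - z x\<^sub>3) / (1 - z x\<^sub>2)\<close> is bounded by 1 on the closed
tetrablock and is a uniform limit of polynomials, so
\<open>\<parallel>(X\<^sub>1 - z X\<^sub>3) y\<parallel> \<le> \<parallel>(1 - z X\<^sub>2) y\<parallel>\<close>, first for \<open>|z| < 1\<close> and then for \<open>|z| = 1\<close>
(\<open>tetrablock_contraction_circle\<close>). Squaring this, and adding the inequality with the indices 1 and 2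
exchanged, the terms \<open>\<parallel>X\<^sub>1 y\<parallel>\<^sup>2\<close> and \<open>\<parallel>X\<^sub>2 y\<parallel>\<^sup>2\<close> cancel and what remains is
\<open>|\<langle>B\<^sub>1 y, y\<rangle>| + |\<langle>B\<^sub>2 y, y\<rangle>| \<le> \<parallel>D y\<parallel>\<^sup>2\<close>, that is,
\<open>|\<langle>F\<^sub>1 s, s\<rangle>| + |\<langle>F\<^sub>2 s, s\<rangle>| \<le> \<parallel>s\<parallel>\<^sup>2\<close> on \<open>S\<close>. Hence \<open>F\<^sub>1\<^sup>* + z F\<^sub>2\<close> has numerical radius at most 1
for \<open>|z| \<le> 1\<close>. It is normal by the first part, and the norm of a normal operator is its numerical
radius (\<open>normal_norm_le_numerical_radius\<close>).

Everything is derived from the inner product: the Riesz representation gives the adjoints, a power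
series gives the square root, and Liouville's theorem for scalar functions gives Fuglede's theorem.\<close>

section \<open>Inner product and norm\<close>

lemma cinner_add_right: "cinner x (y + z) = cinner x y + cinner x z"
  by (metis cinner_add_left cinner_commute complex_cnj_add)

lemma cinner_scaleC_right: "cinner x (c *\<^sub>C y) = cnj c * cinner x y"
  by (metis cinner_commute cinner_scaleC_left complex_cnj_mult)

lemma scaleC_one: "1 *\<^sub>C (x::'a::chilbert_space) = x"
  using scaleR_scaleC[of 1 x] by simp

lemma scaleC_minus_one: "(-1) *\<^sub>C (x::'a::chilbert_space) = - x"
  using scaleR_scaleC[of "-1" x] by simp

lemma scaleC_zero_left [simp]: "0 *\<^sub>C (x::'a::chilbert_space) = 0"
  using scaleR_scaleC[of 0 x] by simp

lemma scaleC_zero_right [simp]: "c *\<^sub>C (0::'a::chilbert_space) = 0"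
  using scaleC_add_right[of c 0 0] by simp

lemma scaleC_diff_right: "c *\<^sub>C (x - y) = c *\<^sub>C x - c *\<^sub>C (y::'a::chilbert_space)"
  using scaleC_add_right[of c "x - y" y] by simp

lemma scaleC_minus_left: "(- c) *\<^sub>C x = - (c *\<^sub>C (x::'a::chilbert_space))"
  using scaleC_scaleC[of "-1" c x] by (simp add: scaleC_minus_one)

lemma scaleC_scaleR: "c *\<^sub>C (r *\<^sub>R x) = r *\<^sub>R (c *\<^sub>C (x::'a::chilbert_space))"
  by (simp add: scaleR_scaleC scaleC_scaleC mult.commute)

lemma cinner_zero_left [simp]: "cinner 0 y = 0"
  using cinner_add_left[of 0 0 y] by simp

lemma cinner_zero_right [simp]: "cinner y 0 = 0"
  using cinner_add_right[of y 0 0] by simp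

lemma cinner_diff_left: "cinner (x - y) z = cinner x z - cinner y z"
  using cinner_add_left[of "x - y" y z] by simp

lemma cinner_diff_right: "cinner z (x - y) = cinner z x - cinner z y"
  using cinner_add_right[of z "x - y" y] by simp

lemma cinner_minus_left: "cinner (- x) z = - cinner x z"
  using cinner_diff_left[of 0 x z] by simp

lemma cinner_minus_right: "cinner z (- x) = - cinner z x"
  using cinner_diff_right[of z 0 x] by simp

lemmas cinner_linear = cinner_add_left cinner_add_right cinner_diff_left cinner_diff_right
  cinner_minus_left cinner_minus_right cinner_scaleC_left cinner_scaleC_right

lemma Re_cinner_commute: "Re (cinner x y) = Re (cinner y x)"
  by (subst cinner_commute) simp

lemma norm_add_sq: "(norm (x + y))\<^sup>2 = (norm x)\<^sup>2 + (norm y)\<^sup>2 + 2 * Re (cinner x (y::'a::chilbert_space))"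
proof -
  have "Re (cinner (x + y) (x + y)) = Re (cinner x x) + Re (cinner y y) + 2 * Re (cinner x y)"
    using Re_cinner_commute[of x y] by (simp add: cinner_linear)
  then show ?thesis
    by (simp add: cinner_self del: of_real_power)
qed

lemma norm_diff_sq: "(norm (x - y))\<^sup>2 = (norm x)\<^sup>2 + (norm y)\<^sup>2 - 2 * Re (cinner x (y::'a::chilbert_space))"
  using norm_add_sq[of x "- y"] by (simp add: cinner_minus_right)

lemma norm_scaleC: "norm (c *\<^sub>C x) = cmod c * norm (x::'a::chilbert_space)"
proof -
  have "complex_of_real ((norm (c *\<^sub>C x))\<^sup>2) = c * cnj c * complex_of_real ((norm x)\<^sup>2)"
    unfolding cinner_self[symmetric] by (simp add: cinner_linear)
  also have "\<dots> = complex_of_real ((cmod c * norm x)\<^sup>2)"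
    by (simp add: complex_norm_square[symmetric] power_mult_distrib)
  finally show ?thesis
    using of_real_eq_iff power2_eq_iff_nonneg by (metis mult_nonneg_nonneg norm_ge_zero)
qed

lemma Re_cinner_le: "Re (cinner x y) \<le> norm x * norm (y::'a::chilbert_space)"
proof (cases "x = 0 \<or> y = 0")
  case False
  have "0 \<le> (norm (norm y *\<^sub>R x - norm x *\<^sub>R y))\<^sup>2"
    by simp
  also have "\<dots> = 2 * (norm x * norm y)\<^sup>2 - 2 * (norm x * norm y * Re (cinner x y))"
    by (simp add: norm_diff_sq cinner_linear scaleR_scaleC norm_scaleC power_mult_distrib
        algebra_simps)
  finally have "norm x * norm y * Re (cinner x y) \<le> (norm x * norm y) * (norm x * norm y)"
    by (simp add: power2_eq_square)
  then show ?thesis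
    using False by (simp add: mult_le_cancel_left)
qed auto

lemma exists_unimodular_rotation: "\<exists>w. cmod w = 1 \<and> w * a = complex_of_real (cmod a)"
proof (cases "a = 0")
  case False
  then have "cmod (cnj a / cmod a) = 1 \<and> (cnj a / cmod a) * a = complex_of_real (cmod a)"
    by (simp add: norm_divide field_simps complex_norm_square[symmetric] power2_eq_square)
  then show ?thesis by blast
qed (auto intro: exI[of _ 1])

lemma cinner_Cauchy_Schwarz: "cmod (cinner x y) \<le> norm x * norm (y::'a::chilbert_space)"
proof -
  obtain w where w: "cmod w = 1" "w * cinner x y = complex_of_real (cmod (cinner x y))"
    using exists_unimodular_rotation by blast
  have "cmod (cinner x y) = Re (cinner (w *\<^sub>C x) y)"
    by (simp add: cinner_linear w)
  also have "\<dots> \<le> norm x * norm y"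
    using Re_cinner_le[of "w *\<^sub>C x" y] by (simp add: norm_scaleC w)
  finally show ?thesis .
qed

lemma bounded_bilinear_cinner: "bounded_bilinear (cinner :: 'a::chilbert_space \<Rightarrow> 'a \<Rightarrow> complex)"
proof
  show "\<exists>K. \<forall>a b::'a. norm (cinner a b) \<le> norm a * norm b * K"
    by (auto intro!: exI[of _ 1] cinner_Cauchy_Schwarz)
qed (simp_all add: cinner_linear scaleR_scaleC[where 'a = 'a] scaleR_conv_of_real)

lemma bounded_linear_scaleC: "bounded_linear (\<lambda>x::'a::chilbert_space. c *\<^sub>C x)"
proof
  show "\<exists>K. \<forall>x::'a. norm (c *\<^sub>C x) \<le> norm x * K"
    by (auto intro!: exI[of _ "cmod c"] simp: norm_scaleC mult.commute)
qed (simp_all add: scaleC_add_right scaleC_scaleR)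

lemmas tendsto_cinner = bounded_bilinear.tendsto[OF bounded_bilinear_cinner]
lemmas tendsto_scaleC = bounded_linear.tendsto[OF bounded_linear_scaleC]

lemma cinner_eqI:
  assumes "\<And>x. cinner x y = cinner x z" shows "y = (z::'a::chilbert_space)"
proof -
  have "cinner (y - z) (y - z) = 0"
    using assms[of "y - z"] by (simp add: cinner_diff_right)
  then show ?thesis
    by (simp add: cinner_self)
qed

section \<open>Closed subspaces, bounded operators and adjoints\<close>

definition closed_csubspace :: "'a::chilbert_space set \<Rightarrow> bool"
  where "closed_csubspace S \<longleftrightarrow>
    closed S \<and> 0 \<in> S \<and> (\<forall>x\<in>S. \<forall>y\<in>S. x + y \<in> S) \<and> (\<forall>c. \<forall>x\<in>S. c *\<^sub>C x \<in> S)"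

lemma closed_csubspaceD:
  assumes "closed_csubspace S"
  shows "closed S" "0 \<in> S" "\<And>x y. x \<in> S \<Longrightarrow> y \<in> S \<Longrightarrow> x + y \<in> S" "\<And>c x. x \<in> S \<Longrightarrow> c *\<^sub>C x \<in> S"
    "\<And>x y. x \<in> S \<Longrightarrow> y \<in> S \<Longrightarrow> x - y \<in> S"
    "\<And>r x. x \<in> S \<Longrightarrow> r *\<^sub>R x \<in> S"
proof -
  show *: "closed S" "0 \<in> S" "\<And>x y. x \<in> S \<Longrightarrow> y \<in> S \<Longrightarrow> x + y \<in> S" "\<And>c x. x \<in> S \<Longrightarrow> c *\<^sub>C x \<in> S"
    using assms by (auto simp: closed_csubspace_def)
  show "x - y \<in> S" if "x \<in> S" "y \<in> S" for x y
    using *(3)[OF that(1) *(4)[OF that(2), of "-1"]] by (simp add: scaleC_minus_one)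
  show "r *\<^sub>R x \<in> S" if "x \<in> S" for r x
    using *(4)[OF that] by (simp add: scaleR_scaleC)
qed

lemma closed_csubspace_UNIV [simp]: "closed_csubspace UNIV"
  by (simp add: closed_csubspace_def)

text \<open>The first-order condition at a minimum, in the form in which quadratic perturbations
produce it.\<close>

lemma linear_coefficient_eq_0:
  fixes d c :: real
  assumes quad: "\<And>t. 0 \<le> 2 * t * d + t\<^sup>2 * c"
  shows "d = 0"
proof (rule ccontr)
  assume d: "d \<noteq> 0"
  define q where "q = 1 + \<bar>c\<bar>"
  have q: "0 < q" "c \<le> q"
    by (auto simp: q_def)
  have "0 \<le> 2 * (- d / q) * d + (- d / q)\<^sup>2 * c"
    by (rule quad)
  also have "\<dots> \<le> 2 * (- d / q) * d + (- d / q)\<^sup>2 * q"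
    using q(2) by (intro add_left_mono mult_left_mono) auto
  also have "\<dots> = - (d\<^sup>2 / q)"
    using q(1) by (simp add: field_simps power2_eq_square)
  also have "\<dots> < 0"
    using d q(1) by simp
  finally show False
    by simp
qed

text \<open>The representing vector is the minimiser of \<open>J x = \<parallel>x\<parallel>\<^sup>2 - 2 Re (\<phi> x)\<close> on \<open>S\<close>. By the parallelogram law
every minimising sequence is Cauchy, and the vanishing of the first variation of \<open>J\<close> at the minimiser
is the representation formula for real parts; multiplication by \<open>\<i>\<close> gives the imaginary parts.\<close>

theorem riesz_representation_on:
  fixes \<phi> :: "'a::chilbert_space \<Rightarrow> complex"
  assumes S: "closed_csubspace S"
    and add: "\<And>x y. x \<in> S \<Longrightarrow> y \<in> S \<Longrightarrow> \<phi> (x + y) = \<phi> x + \<phi> y"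
    and scale: "\<And>c x. x \<in> S \<Longrightarrow> \<phi> (c *\<^sub>C x) = c * \<phi> x"
    and bound: "\<And>x. x \<in> S \<Longrightarrow> cmod (\<phi> x) \<le> K * norm x"
  shows "\<exists>z\<in>S. \<forall>x\<in>S. \<phi> x = cinner x z"
proof -
  note S' = closed_csubspaceD[OF S]
  define J where "J x = (norm x)\<^sup>2 - 2 * Re (\<phi> x)" for x
  define m where "m = (INF x\<in>S. J x)"
  have diff: "\<phi> (x - y) = \<phi> x - \<phi> y" if "x \<in> S" "y \<in> S" for x y
    using add[of "x - y" y] that S' by simp
  have scaleR: "\<phi> (r *\<^sub>R x) = r * \<phi> x" if "x \<in> S" for r x
    using scale[OF that] by (simp add: scaleR_scaleC)
  have "- K\<^sup>2 \<le> J x" if "x \<in> S" for x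
  proof -
    have "Re (\<phi> x) \<le> K * norm x"
      using complex_Re_le_cmod[of "\<phi> x"] bound[OF that] by linarith
    moreover have "0 \<le> (norm x - K)\<^sup>2"
      by simp
    ultimately show ?thesis
      by (simp add: J_def power2_diff algebra_simps)
  qed
  then have bdd: "bdd_below (J ` S)"
    by (auto intro!: bdd_belowI)
  have m_le: "m \<le> J x" if "x \<in> S" for x
    unfolding m_def by (rule cINF_lower[OF bdd that])
  define \<delta> where "\<delta> n = 1 / real (Suc n)" for n
  have \<delta>: "0 < \<delta> n" "n \<le> k \<Longrightarrow> \<delta> k \<le> \<delta> n" for n k
    by (auto simp: \<delta>_def field_simps)
  have "\<exists>x\<in>S. J x < m + \<delta> n" for n
  proof (rule ccontr)
    assume "\<not> ?thesis"
    then have "m + \<delta> n \<le> m"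
      using S'(2) unfolding m_def by (intro cINF_greatest) (auto simp: not_less)
    then show False
      using \<delta>(1)[of n] by simp
  qed
  then obtain x where x: "\<And>n. x n \<in> S" "\<And>n. J (x n) < m + \<delta> n"
    by metis
  (* The parallelogram law, with J at the midpoint bounded below by m. *)
  have dist: "(norm (a - b))\<^sup>2 \<le> 2 * (J a - m) + 2 * (J b - m)" if "a \<in> S" "b \<in> S" for a b
  proof -
    have "m \<le> J ((1/2) *\<^sub>R (a + b))"
      using that S' by (intro m_le) auto
    also have "\<dots> = (norm (a + b))\<^sup>2 / 4 - Re (\<phi> a) - Re (\<phi> b)"
      using that S' by (simp add: J_def scaleR add power_mult_distrib power_divide add_divide_distrib)
    finally show ?thesis
      unfolding J_def norm_add_sq norm_diff_sq by (simp add: field_simps)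
  qed
  have "Cauchy x"
  proof (rule CauchyI)
    fix e :: real assume e: "0 < e"
    then obtain N where N: "\<delta> N < e\<^sup>2 / 4"
      using nat_approx_posE[of "e\<^sup>2 / 4"] unfolding \<delta>_def by (metis divide_pos_pos zero_less_numeral zero_less_power)
    have less_J: "J (x k) - m \<le> \<delta> N" if "N \<le> k" for k
      using x(2)[of k] \<delta>(2)[OF that] by simp
    have "norm (x k - x l) < e" if "k \<ge> N" "l \<ge> N" for k l
    proof -
      have "(norm (x k - x l))\<^sup>2 \<le> 2 * (J (x k) - m) + 2 * (J (x l) - m)"
        using dist x(1) by blast
      also have "\<dots> \<le> 2 * \<delta> N + 2 * \<delta> N"
        using less_J[OF that(1)] less_J[OF that(2)] by (intro add_mono mult_left_mono) auto
      also have "\<dots> < e\<^sup>2"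
        using N by simp
      finally have "(norm (x k - x l))\<^sup>2 < e\<^sup>2" .
      then show ?thesis
        using e by (meson less_imp_le power2_less_imp_less)
    qed
    then show "\<exists>M. \<forall>k\<ge>M. \<forall>l\<ge>M. norm (x k - x l) < e"
      by blast
  qed
  then obtain z where z: "x \<longlonglongrightarrow> z"
    using Cauchy_convergent_iff convergent_def by blast
  have zS: "z \<in> S"
    using closed_sequentially[OF S'(1)] x(1) z by blast
  have "(\<lambda>n. \<phi> (x n)) \<longlonglongrightarrow> \<phi> z"
  proof (rule Lim_null[THEN iffD2], rule Lim_null_comparison)
    show "\<forall>\<^sub>F n in sequentially. norm (\<phi> (x n) - \<phi> z) \<le> K * norm (x n - z)"
      using bound[of "x _ - z"] x(1) zS S' by (simp add: diff[symmetric])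
    show "(\<lambda>n. K * norm (x n - z)) \<longlonglongrightarrow> 0"
      using z by (auto intro!: tendsto_eq_intros simp: LIM_zero tendsto_norm_zero)
  qed
  then have "(\<lambda>n. J (x n)) \<longlonglongrightarrow> J z"
    unfolding J_def by (intro tendsto_intros z)
  moreover have "(\<lambda>n. m + \<delta> n) \<longlonglongrightarrow> m + 0"
    unfolding \<delta>_def by (intro tendsto_intros) (use LIMSEQ_Suc[OF lim_1_over_n] in simp)
  ultimately have "J z \<le> m + 0"
    by (rule LIMSEQ_le) (use x(2) less_imp_le in blast)
  then have min: "J z \<le> J y" if "y \<in> S" for y
    using m_le[OF that] by simp
  have Re_eq: "Re (\<phi> h) = Re (cinner h z)" if h: "h \<in> S" for h
  proof -
    define d where "d = Re (cinner h z) - Re (\<phi> h)"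
    have quad: "0 \<le> 2 * t * d + t\<^sup>2 * (norm h)\<^sup>2" for t
    proof -
      have "J z \<le> J (z + t *\<^sub>R h)"
        using zS h S' by (intro min) auto
      also have "\<dots> = (norm z)\<^sup>2 + t\<^sup>2 * (norm h)\<^sup>2 + 2 * t * Re (cinner h z) - 2 * Re (\<phi> z) - 2 * t * Re (\<phi> h)"
        using zS h S' Re_cinner_commute[of z h]
        by (simp add: J_def add scaleR norm_add_sq power_mult_distrib scaleR_scaleC cinner_linear norm_scaleC scale)
      finally show ?thesis
        by (simp add: J_def d_def algebra_simps)
    qed
    have "d = 0"
      by (rule linear_coefficient_eq_0[OF quad])
    then show ?thesis
      by (simp add: d_def)
  qed
  have "\<phi> h = cinner h z" if h: "h \<in> S" for h
  proof (rule complex_eqI)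
    show "Im (\<phi> h) = Im (cinner h z)"
      using Re_eq[of "\<i> *\<^sub>C h"] h S' scale[OF h] by (simp add: cinner_linear)
  qed (rule Re_eq[OF h])
  then show ?thesis
    using zS by blast
qed

lemma bounded_op_onD:
  assumes "bounded_op_on S T"
  shows "\<And>x. x \<in> S \<Longrightarrow> T x \<in> S" "\<And>x y. x \<in> S \<Longrightarrow> y \<in> S \<Longrightarrow> T (x + y) = T x + T y"
    "\<And>c x. x \<in> S \<Longrightarrow> T (c *\<^sub>C x) = c *\<^sub>C T x"
  using assms by (auto simp: bounded_op_on_def)

lemma bounded_op_on_bound:
  assumes "bounded_op_on S T"
  shows "\<exists>K. 0 \<le> K \<and> (\<forall>x\<in>S. norm (T x) \<le> K * norm x)"
proof -
  obtain K where K: "\<forall>x\<in>S. norm (T x) \<le> K * norm x"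
    using assms unfolding bounded_op_on_def by blast
  have "norm (T x) \<le> \<bar>K\<bar> * norm x" if "x \<in> S" for x
    using bspec[OF K that] abs_ge_self[of K] by (meson mult_right_mono norm_ge_zero order_trans)
  then show ?thesis
    by (intro exI[of _ "\<bar>K\<bar>"]) simp
qed

lemma bounded_op_on_diff:
  assumes "closed_csubspace S" "bounded_op_on S T" "x \<in> S" "y \<in> S"
  shows "T (x - y) = T x - T y"
  using bounded_op_onD(2)[OF assms(2), of "x - y" y] closed_csubspaceD[OF assms(1)] assms(3,4) by simp

lemma bounded_op_onI:
  assumes "\<And>x. x \<in> S \<Longrightarrow> T x \<in> S" "\<And>x y. x \<in> S \<Longrightarrow> y \<in> S \<Longrightarrow> T (x + y) = T x + T y"
    "\<And>c x. x \<in> S \<Longrightarrow> T (c *\<^sub>C x) = c *\<^sub>C T x" "\<And>x. x \<in> S \<Longrightarrow> norm (T x) \<le> K * norm x"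
  shows "bounded_op_on S T"
  unfolding bounded_op_on_def by (intro conjI ballI allI exI[of _ K] assms)

lemma bounded_op_on_tendsto:
  assumes S: "closed_csubspace S" and T: "bounded_op_on S T"
    and x: "\<And>n. x n \<in> S" "l \<in> S" "x \<longlonglongrightarrow> l"
  shows "(\<lambda>n. T (x n)) \<longlonglongrightarrow> T l"
proof -
  obtain K where K: "K \<ge> 0" "\<And>x. x \<in> S \<Longrightarrow> norm (T x) \<le> K * norm x"
    using bounded_op_on_bound[OF T] by blast
  show ?thesis
  proof (rule Lim_null[THEN iffD2], rule Lim_null_comparison)
    show "\<forall>\<^sub>F n in sequentially. norm (T (x n) - T l) \<le> K * norm (x n - l)"
      using K(2)[of "x _ - l"] x closed_csubspaceD[OF S]
      by (simp add: bounded_op_on_diff[OF S T, symmetric])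
    show "(\<lambda>n. K * norm (x n - l)) \<longlonglongrightarrow> 0"
      using x(3) by (auto intro!: tendsto_eq_intros simp: LIM_zero tendsto_norm_zero)
  qed
qed

lemma bounded_op_on_imp_bounded_linear:
  assumes T: "bounded_op_on UNIV T" shows "bounded_linear T"
proof -
  obtain K where "\<And>x. norm (T x) \<le> K * norm x"
    using bounded_op_on_bound[OF T] by blast
  then show ?thesis
    by (intro bounded_linear_intro[where K = K])
      (simp_all add: bounded_op_onD[OF T] scaleR_scaleC[where 'a = 'a] mult.commute)
qed

lemma bounded_op_on_add:
  assumes S: "closed_csubspace S" and A: "bounded_op_on S A" and B: "bounded_op_on S B"
  shows "bounded_op_on S (\<lambda>x. A x + B x)"
proof -
  obtain K L where K: "\<And>x. x \<in> S \<Longrightarrow> norm (A x) \<le> K * norm x"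
    and L: "\<And>x. x \<in> S \<Longrightarrow> norm (B x) \<le> L * norm x"
    using bounded_op_on_bound[OF A] bounded_op_on_bound[OF B] by metis
  show ?thesis
  proof (rule bounded_op_onI[where K = "K + L"])
    show "norm (A x + B x) \<le> (K + L) * norm x" if "x \<in> S" for x
      using norm_triangle_ineq[of "A x" "B x"] K[OF that] L[OF that] by (simp add: distrib_right)
  qed (use bounded_op_onD[OF A] bounded_op_onD[OF B] closed_csubspaceD[OF S] in
      \<open>auto simp: scaleC_add_right\<close>)
qed

lemma bounded_op_on_compose:
  assumes A: "bounded_op_on S A" and B: "bounded_op_on S B"
  shows "bounded_op_on S (\<lambda>x. A (B x))"
proof -
  obtain K L where K: "K \<ge> 0" "\<And>x. x \<in> S \<Longrightarrow> norm (A x) \<le> K * norm x"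
    and L: "\<And>x. x \<in> S \<Longrightarrow> norm (B x) \<le> L * norm x"
    using bounded_op_on_bound[OF A] bounded_op_on_bound[OF B] by metis
  show ?thesis
  proof (rule bounded_op_onI[where K = "K * L"])
    show "norm (A (B x)) \<le> (K * L) * norm x" if "x \<in> S" for x
      using K(2)[OF bounded_op_onD(1)[OF B that]] mult_left_mono[OF L[OF that] K(1)]
      by (simp add: mult.assoc)
  qed (use bounded_op_onD[OF A] bounded_op_onD[OF B] in auto)
qed

lemma bounded_op_on_scaleC:
  assumes S: "closed_csubspace S"
  shows "bounded_op_on S (\<lambda>x. c *\<^sub>C x)"
  using closed_csubspaceD[OF S]
  by (intro bounded_op_onI[where K = "cmod c"])
    (auto simp: scaleC_add_right scaleC_scaleC mult.commute norm_scaleC)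

lemma bounded_op_on_diff_op:
  assumes S: "closed_csubspace S" and A: "bounded_op_on S A" and B: "bounded_op_on S B"
  shows "bounded_op_on S (\<lambda>x. A x - B x)"
  using bounded_op_on_add[OF S A bounded_op_on_compose[OF bounded_op_on_scaleC[OF S, of "-1"] B]]
  by (simp add: scaleC_minus_one)

lemma cinner_ext_on:
  assumes S: "closed_csubspace S" and "y \<in> S" "z \<in> S" "\<And>x. x \<in> S \<Longrightarrow> cinner x y = cinner x z"
  shows "y = z"
proof -
  have "cinner (y - z) (y - z) = 0"
    using assms(4)[of "y - z"] closed_csubspaceD[OF S] assms(2,3) by (simp add: cinner_diff_right)
  then show ?thesis
    by (simp add: cinner_self)
qed

lemma adjoint_on_eqI:
  assumes S: "closed_csubspace S" and z: "z \<in> S" "\<And>x. x \<in> S \<Longrightarrow> cinner (T x) y = cinner x z"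
  shows "adjoint_on S T y = z"
  unfolding adjoint_on_def
proof (rule the_equality)
  show "w = z" if "w \<in> S \<and> (\<forall>x\<in>S. cinner (T x) y = cinner x w)" for w
    using that z by (intro cinner_ext_on[OF S]) auto
qed (use z in auto)

lemma adjoint_on:
  assumes S: "closed_csubspace S" and T: "bounded_op_on S T"
  shows adjoint_on_mem: "y \<in> S \<Longrightarrow> adjoint_on S T y \<in> S"
    and cinner_adjoint_on: "y \<in> S \<Longrightarrow> x \<in> S \<Longrightarrow> cinner (T x) y = cinner x (adjoint_on S T y)"
proof -
  obtain K where K: "K \<ge> 0" "\<And>x. x \<in> S \<Longrightarrow> norm (T x) \<le> K * norm x"
    using bounded_op_on_bound[OF T] by blast
  have "\<exists>z\<in>S. \<forall>x\<in>S. cinner (T x) y = cinner x z"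
  proof (rule riesz_representation_on[OF S, where K = "K * norm y"])
    show "cmod (cinner (T x) y) \<le> K * norm y * norm x" if "x \<in> S" for x
      using cinner_Cauchy_Schwarz[of "T x" y] mult_right_mono[OF K(2)[OF that], of "norm y"]
      by (simp add: mult_ac)
  qed (use bounded_op_onD[OF T] in \<open>auto simp: cinner_linear\<close>)
  then obtain z where z: "z \<in> S" "\<And>x. x \<in> S \<Longrightarrow> cinner (T x) y = cinner x z"
    by blast
  have eq: "adjoint_on S T y = z"
    by (rule adjoint_on_eqI[OF S z])
  show "adjoint_on S T y \<in> S" "x \<in> S \<Longrightarrow> cinner (T x) y = cinner x (adjoint_on S T y)"
    using z by (auto simp: eq)
qed

lemma cinner_adjoint_on_left:
  assumes "closed_csubspace S" "bounded_op_on S T" "x \<in> S" "y \<in> S"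
  shows "cinner (adjoint_on S T y) x = cinner y (T x)"
  by (metis cinner_adjoint_on[OF assms(1,2)] assms(3,4) cinner_commute)

text \<open>Apply Cauchy-Schwarz to \<open>\<parallel>T\<^sup>* y\<parallel>\<^sup>2 = \<langle>T T\<^sup>* y, y\<rangle>\<close>.\<close>

lemma norm_adjoint_on_le:
  assumes S: "closed_csubspace S" and T: "bounded_op_on S T"
    and K: "0 \<le> K" "\<And>x. x \<in> S \<Longrightarrow> norm (T x) \<le> K * norm x" and y: "y \<in> S"
  shows "norm (adjoint_on S T y) \<le> K * norm y"
proof (cases "adjoint_on S T y = 0")
  case False
  let ?z = "adjoint_on S T y"
  note mem = adjoint_on_mem[OF S T y]
  have "norm ?z * norm ?z = cmod (cinner ?z ?z)"
    unfolding cinner_self by (simp add: power2_eq_square norm_mult del: of_real_power of_real_mult)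
  also have "\<dots> = cmod (cinner (T ?z) y)"
    by (simp add: cinner_adjoint_on[OF S T y mem])
  also have "\<dots> \<le> norm (T ?z) * norm y"
    by (rule cinner_Cauchy_Schwarz)
  also have "\<dots> \<le> (K * norm ?z) * norm y"
    by (intro mult_right_mono K mem) auto
  finally show ?thesis
    using False by (simp add: mult.commute mult.left_commute)
qed (use K(1) in auto)

lemma bounded_op_on_adjoint:
  assumes S: "closed_csubspace S" and T: "bounded_op_on S T"
  shows "bounded_op_on S (adjoint_on S T)"
proof -
  note S' = closed_csubspaceD[OF S]
  note mem = adjoint_on_mem[OF S T] and adj = cinner_adjoint_on[OF S T, symmetric]
  obtain K where K: "K \<ge> 0" "\<And>x. x \<in> S \<Longrightarrow> norm (T x) \<le> K * norm x"
    using bounded_op_on_bound[OF T] by blast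
  show ?thesis
  proof (rule bounded_op_onI[where K = K])
    show "norm (adjoint_on S T y) \<le> K * norm y" if "y \<in> S" for y
      by (rule norm_adjoint_on_le[OF S T K that])
    show "adjoint_on S T (x + y) = adjoint_on S T x + adjoint_on S T y" if "x \<in> S" "y \<in> S" for x y
      using that by (intro adjoint_on_eqI[OF S]) (simp_all add: mem S' cinner_add_right adj)
    show "adjoint_on S T (c *\<^sub>C x) = c *\<^sub>C adjoint_on S T x" if "x \<in> S" for c x
      using that by (intro adjoint_on_eqI[OF S]) (simp_all add: mem S' cinner_scaleC_right adj)
  qed (rule mem)
qed

section \<open>Power series in an operator\<close>

text \<open>Mertens' theorem for an arbitrary bounded bilinear map. The error of the triangular partial sums is
dominated by the corresponding error for the two series of norms, which tends to 0 by the theorem for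
real series. It is used with operator application and with the inner product in the role of the product.\<close>

lemma bounded_bilinear_Cauchy_product_sums:
  fixes prod :: "'a::banach \<Rightarrow> 'b::banach \<Rightarrow> 'c::banach"
  assumes "bounded_bilinear prod"
    and a: "summable (\<lambda>k. norm (a k))" and b: "summable (\<lambda>k. norm (b k))"
  shows "(\<lambda>k. \<Sum>i\<le>k. prod (a i) (b (k - i))) sums prod (suminf a) (suminf b)"
proof -
  interpret bounded_bilinear prod by fact
  obtain K where K: "0 \<le> K" "\<And>x y. norm (prod x y) \<le> norm x * norm y * K"
    using nonneg_bounded by blast
  define Q where "Q n = {..<n} \<times> {..<n} - {(i, j). i + j < n}" for n :: nat
  (* The square of side n is the triangle i + j < n together with Q n. *)
  have split: "(\<Sum>k<n. \<Sum>i\<le>k. g i (k - i)) = (\<Sum>(i, j)\<in>{..<n} \<times> {..<n}. g i j) - (\<Sum>(i, j)\<in>Q n. g i j)"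
    for g :: "nat \<Rightarrow> nat \<Rightarrow> 'z::ab_group_add" and n
  proof -
    have sub: "{(i, j). i + j < n} \<subseteq> {..<n} \<times> {..<n}"
      by auto
    have "(\<Sum>k<n. \<Sum>i\<le>k. g i (k - i)) = (\<Sum>(i, j)\<in>{(i, j). i + j < n}. g i j)"
      by (rule sum.triangle_reindex[symmetric])
    also have "\<dots> = (\<Sum>(i, j)\<in>{..<n} \<times> {..<n}. g i j) - (\<Sum>(i, j)\<in>Q n. g i j)"
      unfolding Q_def by (subst sum_diff) (use sub in auto)
    finally show ?thesis .
  qed
  have "(\<lambda>n. \<Sum>k<n. \<Sum>i\<le>k. norm (a i) * norm (b (k - i)))
      \<longlonglongrightarrow> suminf (\<lambda>k. norm (a k)) * suminf (\<lambda>k. norm (b k))"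
    using Cauchy_product_sums[of "\<lambda>k. norm (a k)" "\<lambda>k. norm (b k)"] a b by (simp add: sums_def)
  moreover have "(\<lambda>n. \<Sum>(i, j)\<in>{..<n} \<times> {..<n}. norm (a i) * norm (b j))
      \<longlonglongrightarrow> suminf (\<lambda>k. norm (a k)) * suminf (\<lambda>k. norm (b k))"
    unfolding sum.cartesian_product[symmetric] sum_product[symmetric]
    by (intro tendsto_mult summable_LIMSEQ a b)
  ultimately have "(\<lambda>n. (\<Sum>(i, j)\<in>{..<n} \<times> {..<n}. norm (a i) * norm (b j)) -
      (\<Sum>k<n. \<Sum>i\<le>k. norm (a i) * norm (b (k - i)))) \<longlonglongrightarrow> 0"
    using tendsto_diff by fastforce
  then have "(\<lambda>n. K * (\<Sum>(i, j)\<in>Q n. norm (a i) * norm (b j))) \<longlonglongrightarrow> 0"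
    unfolding split[of "\<lambda>i j. norm (a i) * norm (b j)"] by (auto intro!: tendsto_eq_intros)
  then have Q0: "(\<lambda>n. \<Sum>(i, j)\<in>Q n. prod (a i) (b j)) \<longlonglongrightarrow> 0"
  proof (rule Lim_null_comparison[rotated], intro always_eventually allI)
    fix n
    show "norm (\<Sum>(i, j)\<in>Q n. prod (a i) (b j)) \<le> K * (\<Sum>(i, j)\<in>Q n. norm (a i) * norm (b j))"
      unfolding sum_distrib_left
      by (rule order_trans[OF norm_sum sum_mono]) (use K in \<open>auto simp: mult.commute\<close>)
  qed
  have "(\<lambda>n. prod (\<Sum>k<n. a k) (\<Sum>k<n. b k)) \<longlonglongrightarrow> prod (suminf a) (suminf b)"
    by (rule tendsto[OF summable_LIMSEQ[OF summable_norm_cancel[OF a]]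
          summable_LIMSEQ[OF summable_norm_cancel[OF b]]])
  then have "(\<lambda>n. \<Sum>(i, j)\<in>{..<n} \<times> {..<n}. prod (a i) (b j)) \<longlonglongrightarrow> prod (suminf a) (suminf b)"
    unfolding sum_left unfolding sum_right unfolding sum.cartesian_product .
  from tendsto_diff[OF this Q0] show ?thesis
    unfolding sums_def split[of "\<lambda>i j. prod (a i) (b j)"] by simp
qed

lemma bounded_op_on_funpow: "bounded_op_on S A \<Longrightarrow> bounded_op_on S (A ^^ n)"
proof (induction n)
  case 0
  then show ?case by (auto simp: bounded_op_on_def intro: exI[of _ 1])
next
  case (Suc n)
  then show ?case
    using bounded_op_on_compose[of S A "A ^^ n"] by (simp add: o_def)
qed

lemma norm_funpow_le:
  fixes A :: "'a::real_normed_vector \<Rightarrow> 'a"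
  assumes "0 \<le> K" "\<And>x. norm (A x) \<le> K * norm x"
  shows "norm ((A ^^ n) x) \<le> K ^ n * norm x"
proof (induction n)
  case (Suc n)
  have "norm ((A ^^ Suc n) x) \<le> K * norm ((A ^^ n) x)"
    using assms(2) by simp
  also have "\<dots> \<le> K * (K ^ n * norm x)"
    by (intro mult_left_mono Suc assms)
  finally show ?case by (simp add: mult.assoc)
qed simp

lemma funpow_commute_op:
  assumes "\<And>x. A (B x) = B (A x)" shows "(A ^^ n) (B x) = B ((A ^^ n) x)"
  by (induction n) (auto simp: assms)

text \<open>The series is summed pointwise, so that convergence is that of vectors. In the locale below, \<open>K\<close> is a
bound of the operator at which the scalar series converges absolutely.\<close>

definition power_series_op :: "(nat \<Rightarrow> real) \<Rightarrow> ('a::real_normed_vector \<Rightarrow> 'a) \<Rightarrow> 'a \<Rightarrow> 'a"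
  where "power_series_op c A x = suminf (\<lambda>n. c n *\<^sub>R (A ^^ n) x)"

locale op_series =
  fixes c :: "nat \<Rightarrow> real" and A :: "'a::chilbert_space \<Rightarrow> 'a" and K :: real
  assumes A: "bounded_op_on UNIV A" and K: "0 \<le> K" "\<And>x. norm (A x) \<le> K * norm x"
    and c: "summable (\<lambda>n. \<bar>c n\<bar> * K ^ n)"
begin

lemma norm_term: "norm (c n *\<^sub>R (A ^^ n) x) \<le> (\<bar>c n\<bar> * K ^ n) * norm x"
  using mult_left_mono[OF norm_funpow_le[OF K, of n x], of "\<bar>c n\<bar>"] by (simp add: mult.assoc)

lemma summable_norm: "summable (\<lambda>n. norm (c n *\<^sub>R (A ^^ n) x))"
  by (rule summable_comparison_test'[OF summable_mult2[OF c, of "norm x"], of 0])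
    (use norm_term in simp)

lemma summable: "summable (\<lambda>n. c n *\<^sub>R (A ^^ n) x)"
  by (rule summable_norm_cancel[OF summable_norm])

lemma bounded_linear_power_series_op:
  assumes L: "bounded_linear L"
  shows "(suminf (\<lambda>n. c n *\<^sub>R L ((A ^^ n) x))) = L (power_series_op c A x)"
  unfolding power_series_op_def bounded_linear.suminf[OF L summable]
  by (simp add: linear_simps(5)[OF L])

lemma norm_power_series_op: "norm (power_series_op c A x) \<le> (suminf (\<lambda>n. \<bar>c n\<bar> * K ^ n)) * norm x"
proof -
  have "norm (power_series_op c A x) \<le> (suminf (\<lambda>n. norm (c n *\<^sub>R (A ^^ n) x)))"
    unfolding power_series_op_def by (rule Series.summable_norm[OF summable_norm])
  also have "\<dots> \<le> (suminf (\<lambda>n. \<bar>c n\<bar> * K ^ n * norm x))"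
    by (intro suminf_le norm_term summable_norm summable_mult2 c)
  also have "\<dots> = (suminf (\<lambda>n. \<bar>c n\<bar> * K ^ n)) * norm x"
    by (rule suminf_mult2[OF c, symmetric])
  finally show ?thesis .
qed

lemma bounded_op_power_series_op: "bounded_op_on UNIV (power_series_op c A)"
proof (rule bounded_op_onI[OF _ _ _ norm_power_series_op])
  note An = bounded_op_onD[OF bounded_op_on_funpow[OF A], simplified]
  show "power_series_op c A (x + y) = power_series_op c A x + power_series_op c A y" for x y
    unfolding power_series_op_def suminf_add[OF summable summable]
    by (simp add: An scaleR_add_right)
  show "power_series_op c A (d *\<^sub>C x) = d *\<^sub>C power_series_op c A x" for d x
    using bounded_linear_power_series_op[OF bounded_linear_scaleC, of d x]
    by (simp add: power_series_op_def An)
qed simp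

lemma power_series_op_commute:
  assumes B: "bounded_op_on UNIV B" and AB: "\<And>x. A (B x) = B (A x)"
  shows "power_series_op c A (B x) = B (power_series_op c A x)"
  using bounded_linear_power_series_op[OF bounded_op_on_imp_bounded_linear[OF B], of x]
  by (simp add: power_series_op_def funpow_commute_op[of A B, OF AB])

lemma power_series_op_adjoint:
  assumes B: "op_series c B K" and AB: "\<And>x y. cinner (A x) y = cinner x (B y)"
  shows "cinner (power_series_op c A x) y = cinner x (power_series_op c B y)"
proof -
  interpret B: op_series c B K by fact
  have *: "cinner ((A ^^ n) x) y = cinner x ((B ^^ n) y)" for n
    by (induction n arbitrary: y) (auto simp: AB funpow_swap1[of B])
  have "cinner (power_series_op c A x) y = (suminf (\<lambda>n. c n *\<^sub>R cinner ((A ^^ n) x) y))"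
    by (rule bounded_linear_power_series_op[symmetric,
          OF bounded_bilinear.bounded_linear_left[OF bounded_bilinear_cinner]])
  also have "\<dots> = (suminf (\<lambda>n. c n *\<^sub>R cinner x ((B ^^ n) y)))"
    by (simp add: *)
  also have "\<dots> = cinner x (power_series_op c B y)"
    by (rule B.bounded_linear_power_series_op[
          OF bounded_bilinear.bounded_linear_right[OF bounded_bilinear_cinner]])
  finally show ?thesis .
qed

text \<open>Composing two power series in the same operator multiplies them formally: the Cauchy product of the
series of operators \<open>c\<^sub>n A\<^sup>n\<close> with the series of vectors \<open>d\<^sub>n A\<^sup>n x\<close>.\<close>

lemma power_series_op_mult:
  assumes "op_series d A K"
  shows "(\<lambda>k. (\<Sum>i\<le>k. c i * d (k - i)) *\<^sub>R (A ^^ k) x)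
    sums power_series_op c A (power_series_op d A x)"
proof -
  interpret d: op_series d A K by fact
  define P where "P n = Blinfun (A ^^ n)" for n
  have P: "blinfun_apply (P n) = A ^^ n" for n
    unfolding P_def
    by (rule bounded_linear_Blinfun_apply[OF bounded_op_on_imp_bounded_linear[OF bounded_op_on_funpow[OF A]]])
  have "norm (c n *\<^sub>R P n) \<le> \<bar>c n\<bar> * K ^ n" for n
    using norm_term[of n] K(1)
    by (intro norm_blinfun_bound) (auto simp: scaleR_blinfun.rep_eq P)
  then have sum_P: "summable (\<lambda>n. norm (c n *\<^sub>R P n))"
    by (intro summable_comparison_test'[OF c, of 0]) simp
  have "(\<lambda>k. \<Sum>i\<le>k. blinfun_apply (c i *\<^sub>R P i) (d (k - i) *\<^sub>R (A ^^ (k - i)) x))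
      sums blinfun_apply (suminf (\<lambda>k. c k *\<^sub>R P k)) (suminf (\<lambda>k. d k *\<^sub>R (A ^^ k) x))"
    by (rule bounded_bilinear_Cauchy_product_sums[OF bounded_bilinear_blinfun_apply sum_P d.summable_norm])
  moreover have "blinfun_apply (suminf (\<lambda>k. c k *\<^sub>R P k)) y = power_series_op c A y" for y
    using bounded_linear.suminf[OF bounded_bilinear.bounded_linear_left[OF
        bounded_bilinear_blinfun_apply] summable_norm_cancel[OF sum_P], of y]
    by (simp add: power_series_op_def scaleR_blinfun.rep_eq P)
  moreover have "(\<Sum>i\<le>k. blinfun_apply (c i *\<^sub>R P i) (d (k - i) *\<^sub>R (A ^^ (k - i)) x))
      = (\<Sum>i\<le>k. c i * d (k - i)) *\<^sub>R (A ^^ k) x" for k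
    unfolding scaleR_sum_left
  proof (rule sum.cong[OF refl])
    fix i assume "i \<in> {..k}"
    then have "(A ^^ i) ((A ^^ (k - i)) x) = (A ^^ (i + (k - i))) x" "i + (k - i) = k"
      by (simp_all only: funpow_add o_apply) auto
    then have "blinfun_apply (P i) ((A ^^ (k - i)) x) = (A ^^ k) x"
      unfolding P by (simp only:)
    then show "blinfun_apply (c i *\<^sub>R P i) (d (k - i) *\<^sub>R (A ^^ (k - i)) x)
        = (c i * d (k - i)) *\<^sub>R (A ^^ k) x"
      by (simp only: blinfun.scaleR_left blinfun.scaleR_right scaleR_scaleR mult.commute[of "d (k - i)"])
  qed
  ultimately show ?thesis
    by (simp only: power_series_op_def)
qed

end

section \<open>Positive operators and the defect operator\<close>

text \<open>Over the complex numbers the values of the quadratic form at \<open>x + y\<close> and \<open>x + \<i> y\<close> determine the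
sesquilinear form, so a real quadratic form comes from a self-adjoint operator.\<close>

lemma positive_op_self_adjoint:
  assumes A: "positive_op A"
  shows "cinner (A x) y = cinner x (A y)"
proof -
  have bd: "bounded_op_on UNIV A" and Im0: "Im (cinner (A x) x) = 0" for x
    using A by (auto simp: positive_op_def complex_nonneg_Reals_iff)
  note lin = bounded_op_onD[OF bd, simplified] cinner_linear
  have "Im (cinner (A x) y) = - Im (cinner (A y) x)"
    using Im0[of "x + y"] Im0[of x] Im0[of y] by (simp add: lin)
  moreover have "Re (cinner (A x) y) = Re (cinner (A y) x)"
    using Im0[of "x + \<i> *\<^sub>C y"] Im0[of x] Im0[of y] by (simp add: lin)
  ultimately have "cinner (A x) y = cnj (cinner (A y) x)"
    by (simp add: complex_eq_iff)
  then show ?thesis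
    using cinner_commute by metis
qed

text \<open>The quadratic form has its minimum 0 at \<open>y\<close>, so its derivative in the direction \<open>A y\<close>, which is
\<open>2 \<parallel>A y\<parallel>\<^sup>2\<close>, vanishes.\<close>

lemma positive_op_eq_0I:
  assumes A: "positive_op A" and 0: "Re (cinner (A y) y) = 0"
  shows "A y = 0"
proof -
  have bd: "bounded_op_on UNIV A" and ge0: "0 \<le> Re (cinner (A x) x)" for x
    using A by (auto simp: positive_op_def complex_nonneg_Reals_iff)
  note lin = bounded_op_onD[OF bd, simplified] cinner_linear
  have "0 \<le> 2 * t * (norm (A y))\<^sup>2 + t\<^sup>2 * Re (cinner (A (A y)) (A y))" for t
  proof -
    have "0 \<le> Re (cinner (A (y + complex_of_real t *\<^sub>C A y)) (y + complex_of_real t *\<^sub>C A y))"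
      by (rule ge0)
    also have "\<dots> = 2 * t * (norm (A y))\<^sup>2 + t\<^sup>2 * Re (cinner (A (A y)) (A y))"
      by (simp add: lin 0 positive_op_self_adjoint[OF A, of "A y" y])
        (simp add: cinner_self power2_eq_square algebra_simps)
    finally show ?thesis .
  qed
  then have "(norm (A y))\<^sup>2 = 0"
    by (rule linear_coefficient_eq_0)
  then show ?thesis
    by simp
qed

text \<open>The coefficients of \<open>y(t) = 1 - sqrt (1 - t)\<close>, read off from \<open>y = (t + y\<^sup>2) / 2\<close>. The sum omits the end
points \<open>0\<close> and \<open>n\<close>, which makes the recursion well-founded and is correct since \<open>y(0) = 0\<close>.\<close>

fun sqrt_coeff :: "nat \<Rightarrow> real"
  where "sqrt_coeff n = ((if n = 1 then 1 else 0) + (\<Sum>i\<in>{1..<n}. sqrt_coeff i * sqrt_coeff (n - i))) / 2"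

declare sqrt_coeff.simps [simp del]

lemma sqrt_coeff_0 [simp]: "sqrt_coeff 0 = 0"
  by (subst sqrt_coeff.simps) simp

lemma sqrt_coeff_nonneg: "0 \<le> sqrt_coeff n"
proof (induction n rule: less_induct)
  case (less n)
  then show ?case
    by (subst sqrt_coeff.simps) (auto intro!: sum_nonneg mult_nonneg_nonneg)
qed

lemma sqrt_coeff_convolution:
  "(\<Sum>i\<le>n. sqrt_coeff i * sqrt_coeff (n - i)) = 2 * sqrt_coeff n - (if n = 1 then 1 else 0)"
proof -
  have "(\<Sum>i\<le>n. sqrt_coeff i * sqrt_coeff (n - i)) = (\<Sum>i\<in>{1..<n}. sqrt_coeff i * sqrt_coeff (n - i))"
    by (rule sum.mono_neutral_right) (auto simp: not_less Suc_le_eq)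
  also have "\<dots> = 2 * sqrt_coeff n - (if n = 1 then 1 else 0)"
    by (subst (3) sqrt_coeff.simps) simp
  finally show ?thesis .
qed

text \<open>The coefficients are summable up to the boundary point \<open>t = 1\<close>: if the first \<open>N\<close> of them have sum at
most 1, the recursion bounds the next partial sum by \<open>(1 + 1\<^sup>2) / 2\<close>.\<close>

lemma sum_sqrt_coeff_le: "(\<Sum>n\<le>N. sqrt_coeff n) \<le> 1"
proof (induction N)
  case (Suc N)
  let ?c = sqrt_coeff
  have "(\<Sum>n\<le>Suc N. \<Sum>i\<le>n. ?c i * ?c (n - i)) = (\<Sum>(i, j)\<in>{(i, j). i + j \<le> Suc N}. ?c i * ?c j)"
    by (rule sum.triangle_reindex_eq[symmetric])
  (* Dropping the vanishing terms with i = 0 or j = 0 confines both indices to {..N}. *)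
  also have "\<dots> = (\<Sum>(i, j)\<in>{(i, j). i + j \<le> Suc N \<and> i \<noteq> 0 \<and> j \<noteq> 0}. ?c i * ?c j)"
  proof (rule sum.mono_neutral_right)
    show "finite {(i, j). i + j \<le> Suc N}"
      by (rule finite_subset[of _ "{..Suc N} \<times> {..Suc N}"]) auto
  qed (auto intro!: gr0I)
  also have "\<dots> \<le> (\<Sum>(i, j)\<in>{..N} \<times> {..N}. ?c i * ?c j)"
    by (rule sum_mono2) (auto intro: mult_nonneg_nonneg sqrt_coeff_nonneg)
  also have "\<dots> = (\<Sum>n\<le>N. ?c n) * (\<Sum>n\<le>N. ?c n)"
    by (simp add: sum_product sum.cartesian_product)
  also have "\<dots> \<le> 1"
    using mult_mono[OF Suc Suc] by (simp add: sum_nonneg sqrt_coeff_nonneg)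
  finally have "(\<Sum>n\<le>Suc N. 2 * ?c n - (if n = 1 then 1 else 0)) \<le> 1"
    unfolding sqrt_coeff_convolution .
  moreover have "(\<Sum>n\<le>Suc N. if n = 1 then 1 else 0) = (1::real)"
    by (subst sum.delta) auto
  ultimately have "2 * (\<Sum>n\<le>Suc N. ?c n) - 1 \<le> 1"
    by (simp only: sum_subtractf sum_distrib_left[symmetric])
  then show ?case
    by simp
qed simp

lemma summable_sqrt_coeff: "summable sqrt_coeff"
  by (rule bounded_imp_summable[OF sqrt_coeff_nonneg sum_sqrt_coeff_le])

lemma suminf_sqrt_coeff_le: "suminf sqrt_coeff \<le> 1"
proof (rule suminf_le_const[OF summable_sqrt_coeff])
  show "sum sqrt_coeff {..<n} \<le> 1" for n
    by (rule order_trans[OF sum_mono2[of "{..n}"] sum_sqrt_coeff_le[of n]])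
      (auto simp: sqrt_coeff_nonneg)
qed

text \<open>For \<open>Y = \<Sum> c\<^sub>n P\<^sup>n\<close> with the coefficients above, \<open>Y\<^sup>2 = 2 Y - P\<close>, hence \<open>(1 - Y)\<^sup>2 = 1 - P\<close>. The operator
\<open>1 - Y\<close> is positive because \<open>\<parallel>Y\<parallel> \<le> \<Sum> c\<^sub>n \<le> 1\<close>, and it commutes with whatever commutes with \<open>P\<close>.\<close>

lemma one_minus_has_sqrt:
  assumes P: "bounded_op_on UNIV P" "\<And>x y. cinner (P x) y = cinner x (P y)" "\<And>x. norm (P x) \<le> norm x"
  shows "\<exists>D. positive_op D \<and> (\<forall>x. D (D x) = x - P x) \<and>
    (\<forall>B. bounded_op_on UNIV B \<longrightarrow> (\<forall>x. P (B x) = B (P x)) \<longrightarrow> (\<forall>x. D (B x) = B (D x)))"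
proof -
  interpret op_series sqrt_coeff P 1
    by standard (use P summable_sqrt_coeff sqrt_coeff_nonneg in auto)
  let ?Y = "power_series_op sqrt_coeff P"
  note Y = bounded_op_power_series_op
  define D where "D x = x - ?Y x" for x
  have comm: "D (B x) = B (D x)" if "bounded_op_on UNIV B" "\<And>y. P (B y) = B (P y)" for B x
    using power_series_op_commute[of B, OF that, of x]
      bounded_op_on_diff[OF closed_csubspace_UNIV that(1), of x] by (simp add: D_def)
  have "bounded_op_on UNIV D"
    using bounded_op_on_diff_op[OF _ bounded_op_on_scaleC[of UNIV 1] Y]
    by (simp add: scaleC_one D_def[abs_def])
  moreover have "cinner (D x) x \<in> \<real>\<^sub>\<ge>\<^sub>0" for x
  proof -
    have "cinner (?Y x) x = cinner x (?Y x)"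
      by (rule power_series_op_adjoint[OF op_series_axioms P(2)])
    then have "Im (cinner (?Y x) x) = 0"
      by (metis cinner_commute Reals_cnj_iff complex_is_Real_iff)
    moreover have "Re (cinner (?Y x) x) \<le> (norm x)\<^sup>2"
    proof -
      have "norm (?Y x) \<le> 1 * norm x"
        using norm_power_series_op[of x] mult_right_mono[OF suminf_sqrt_coeff_le, of "norm x"]
        by (simp add: sqrt_coeff_nonneg)
      then have "norm (?Y x) * norm x \<le> norm x * norm x"
        by (intro mult_right_mono) auto
      then show ?thesis
        using Re_cinner_le[of "?Y x" x] by (simp add: power2_eq_square)
    qed
    ultimately show ?thesis
      by (simp add: D_def cinner_linear complex_nonneg_Reals_iff cinner_self del: of_real_power)
  qed
  ultimately have "positive_op D"
    by (simp add: positive_op_def)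
  moreover have "D (D x) = x - P x" for x
  proof -
    have "(\<lambda>k. 2 *\<^sub>R (sqrt_coeff k *\<^sub>R (P ^^ k) x) - (if k = 1 then 1 else 0) *\<^sub>R (P ^^ k) x) sums ?Y (?Y x)"
      using power_series_op_mult[OF op_series_axioms, of x]
      unfolding sqrt_coeff_convolution by (simp add: scaleR_diff_left)
    moreover have "(\<lambda>k. 2 *\<^sub>R (sqrt_coeff k *\<^sub>R (P ^^ k) x)) sums (2 *\<^sub>R ?Y x)"
      unfolding power_series_op_def by (intro sums_scaleR_right summable_sums summable)
    moreover have "(\<lambda>k. (if k = 1 then 1 else 0) *\<^sub>R (P ^^ k) x) sums P x"
      using sums_single[of 1 "\<lambda>k. (P ^^ k) x"] by (simp add: if_distrib[of "\<lambda>r. r *\<^sub>R _"] cong: if_cong)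
    ultimately have "?Y (?Y x) = 2 *\<^sub>R ?Y x - P x"
      using sums_diff sums_unique2 by blast
    then show ?thesis
      unfolding D_def bounded_op_on_diff[OF closed_csubspace_UNIV Y UNIV_I UNIV_I]
      by (simp add: scaleR_2)
  qed
  ultimately show ?thesis
    using comm by blast
qed

text \<open>Uniqueness of the positive square root. Another root \<open>B\<close> commutes with \<open>B\<^sup>2 = 1 - P\<close>, hence with the root
\<open>E\<close> already constructed. Then \<open>y = (B - E) x\<close> satisfies \<open>(B + E) y = (B\<^sup>2 - E\<^sup>2) x = 0\<close>; the two
nonnegative numbers \<open>\<langle>B y, y\<rangle>\<close> and \<open>\<langle>E y, y\<rangle>\<close> add up to 0, so \<open>B y = E y = 0\<close>, and therefore
\<open>\<parallel>y\<parallel>\<^sup>2 = \<langle>x, (B - E) y\<rangle> = 0\<close>.\<close>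

lemma op_sqrt_one_minus:
  assumes P: "bounded_op_on UNIV P" "\<And>x y. cinner (P x) y = cinner x (P y)" "\<And>x. norm (P x) \<le> norm x"
  defines "D \<equiv> op_sqrt (\<lambda>x. x - P x)"
  shows "positive_op D" "\<And>x. D (D x) = x - P x"
    "\<And>B x. bounded_op_on UNIV B \<Longrightarrow> (\<And>y. P (B y) = B (P y)) \<Longrightarrow> D (B x) = B (D x)"
proof -
  obtain E where E: "positive_op E" "\<And>x. E (E x) = x - P x"
    "\<And>B x. bounded_op_on UNIV B \<Longrightarrow> (\<And>y. P (B y) = B (P y)) \<Longrightarrow> E (B x) = B (E x)"
    using one_minus_has_sqrt[OF P] by blast
  have "D = E"
    unfolding D_def op_sqrt_def
  proof (rule the_equality)
    fix B assume B: "positive_op B \<and> (\<forall>x. B (B x) = x - P x)"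
    have bB: "bounded_op_on UNIV B" and bE: "bounded_op_on UNIV E"
      using B E(1) by (auto simp: positive_op_def)
    have diff: "B (x - y) = B x - B y" "E (x - y) = E x - E y" for x y
      using bounded_op_on_diff[OF _ bB] bounded_op_on_diff[OF _ bE] by auto
    have PB: "P (B x) = B (P x)" for x
    proof -
      have "B x - P (B x) = B (x - P x)"
        using B by metis
      then show ?thesis
        by (simp add: diff)
    qed
    have EB: "E (B x) = B (E x)" for x
      by (rule E(3)[OF bB PB])
    show "B = E"
    proof
      fix x
      define y where "y = B x - E x"
      have sum0: "B y + E y = 0"
        using B E(2)[of x] EB[of x] by (simp add: y_def diff)
      then have "Re (cinner (B y) y) + Re (cinner (E y) y) = 0"
        by (metis cinner_add_left cinner_zero_left plus_complex.simps(1) zero_complex.simps(1))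
      moreover have "0 \<le> Re (cinner (B y) y)" "0 \<le> Re (cinner (E y) y)"
        using B E(1) by (auto simp: positive_op_def complex_nonneg_Reals_iff)
      ultimately have By: "B y = 0"
        using B by (intro positive_op_eq_0I) auto
      then have Ey: "E y = 0"
        using sum0 by simp
      have "cinner y y = cinner x (B y) - cinner x (E y)"
        using B E(1) by (simp add: y_def cinner_diff_left positive_op_self_adjoint)
      then have "cinner y y = 0"
        by (simp add: By Ey)
      then show "B x = E x"
        by (simp add: cinner_self y_def)
    qed
  qed (use E in auto)
  then show "positive_op D" "\<And>x. D (D x) = x - P x"
    "\<And>B x. bounded_op_on UNIV B \<Longrightarrow> (\<And>y. P (B y) = B (P y)) \<Longrightarrow> D (B x) = B (D x)"
    using E by auto
qed

text \<open>These are the properties of the defect operator on which the later arguments rest; \<open>X\<^sup>* X\<close> plays the role of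
\<open>P\<close> above.\<close>

lemma defect_op:
  assumes X: "bounded_op_on UNIV X" and contr: "\<And>x. norm (X x) \<le> norm x"
  shows "positive_op (defect_op X)"
    and "defect_op X (defect_op X x) = x - adjoint_on UNIV X (X x)"
    and "bounded_op_on UNIV B \<Longrightarrow> (\<And>x. X (B x) = B (X x)) \<Longrightarrow>
      (\<And>x. adjoint_on UNIV X (B x) = B (adjoint_on UNIV X x)) \<Longrightarrow> defect_op X (B x) = B (defect_op X x)"
    and "(norm (defect_op X x))\<^sup>2 = (norm x)\<^sup>2 - (norm (X x))\<^sup>2"
proof -
  note U = closed_csubspace_UNIV
  define P where "P x = adjoint_on UNIV X (X x)" for x
  have D_eq: "defect_op X = op_sqrt (\<lambda>x. x - P x)"
    by (simp add: defect_op_def P_def)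
  note adj = cinner_adjoint_on[OF U X UNIV_I UNIV_I] cinner_adjoint_on_left[OF U X UNIV_I UNIV_I]
  have P: "bounded_op_on UNIV P" "cinner (P x) y = cinner x (P y)" "norm (P x) \<le> norm x" for x y
  proof -
    show "bounded_op_on UNIV P"
      unfolding P_def[abs_def] by (rule bounded_op_on_compose[OF bounded_op_on_adjoint[OF U X] X])
    show "cinner (P x) y = cinner x (P y)"
      by (simp add: P_def adj)
    have "norm (P x) \<le> 1 * norm (X x)"
      unfolding P_def using contr by (intro norm_adjoint_on_le[OF U X]) auto
    then show "norm (P x) \<le> norm x"
      using contr[of x] by simp
  qed
  note D = op_sqrt_one_minus[OF P, folded D_eq]
  show pos: "positive_op (defect_op X)"
    by (rule D(1))
  show sq: "defect_op X (defect_op X x) = x - adjoint_on UNIV X (X x)" for x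
    using D(2) by (simp only: P_def)
  show "defect_op X (B x) = B (defect_op X x)" if B: "bounded_op_on UNIV B" "\<And>x. X (B x) = B (X x)"
    "\<And>x. adjoint_on UNIV X (B x) = B (adjoint_on UNIV X x)"
    by (rule D(3)[OF B(1)]) (simp only: P_def B(2,3))
  have "complex_of_real ((norm (defect_op X x))\<^sup>2) = cinner (defect_op X (defect_op X x)) x"
    by (simp only: cinner_self[symmetric] positive_op_self_adjoint[OF pos])
  also have "\<dots> = complex_of_real ((norm x)\<^sup>2 - (norm (X x))\<^sup>2)"
    by (simp add: sq cinner_diff_left adj cinner_self)
  finally show "(norm (defect_op X x))\<^sup>2 = (norm x)\<^sup>2 - (norm (X x))\<^sup>2"
    by (simp only: of_real_eq_iff)
qed

section \<open>Fuglede's theorem\<close>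

definition exp_op :: "('a::chilbert_space \<Rightarrow> 'a) \<Rightarrow> 'a \<Rightarrow> 'a"
  where "exp_op A = power_series_op (\<lambda>n. inverse (fact n)) A"

lemma op_series_exp:
  assumes A: "bounded_op_on UNIV A"
  obtains K where "op_series (\<lambda>n. inverse (fact n)) A K" "op_series (\<lambda>n. (-1) ^ n * inverse (fact n)) A K"
proof -
  obtain K where K: "0 \<le> K" "\<And>x. norm (A x) \<le> K * norm x"
    using bounded_op_on_bound[OF A] by blast
  have "summable (\<lambda>n. inverse (fact n) * K ^ n)"
    using summable_exp[of K] by simp
  then show ?thesis
    using A K by (intro that; unfold_locales) (auto simp: abs_mult)
qed

lemma bounded_op_exp_op: "bounded_op_on UNIV A \<Longrightarrow> bounded_op_on UNIV (exp_op A)"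
  unfolding exp_op_def by (metis op_series_exp op_series.bounded_op_power_series_op)

lemma exp_op_commute:
  assumes A: "bounded_op_on UNIV A" and B: "bounded_op_on UNIV B" and AB: "\<And>x. A (B x) = B (A x)"
  shows "exp_op A (B x) = B (exp_op A x)"
proof -
  obtain K where "op_series (\<lambda>n. inverse (fact n)) A K"
    using op_series_exp[OF A] by metis
  then interpret op_series "\<lambda>n. inverse (fact n)" A K .
  show ?thesis
    unfolding exp_op_def by (rule power_series_op_commute[OF B AB])
qed

lemma exp_op_minus:
  assumes A: "bounded_op_on UNIV A"
  shows "exp_op A (exp_op (\<lambda>x. - A x) x) = x"
proof -
  obtain K where 1: "op_series (\<lambda>n. inverse (fact n)) A K"
    and 2: "op_series (\<lambda>n. (-1) ^ n * inverse (fact n)) A K"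
    using op_series_exp[OF A] by metis
  have pow: "((\<lambda>x. - A x) ^^ n) y = (-1) ^ n *\<^sub>R (A ^^ n) y" for n y
    using bounded_op_on_diff[OF closed_csubspace_UNIV A, of 0] bounded_op_onD(3)[OF A, of _ 0]
    by (induction n) (auto simp: uminus_power_if)
  have exp_minus: "exp_op (\<lambda>x. - A x) y = power_series_op (\<lambda>n. (-1) ^ n * inverse (fact n)) A y" for y
    by (simp add: exp_op_def power_series_op_def pow mult.commute)
  have conv: "(\<Sum>i\<le>k. inverse (fact i) * ((-1) ^ (k - i) * inverse (fact (k - i)))) = (if k = 0 then 1 else (0::real))" for k
  proof -
    have "(\<Sum>i\<le>k. inverse (fact i) * ((-1) ^ (k - i) * inverse (fact (k - i))))
        = (\<Sum>i\<le>k. of_nat (k choose i) * 1 ^ i * (-1) ^ (k - i)) / (fact k :: real)"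
      unfolding sum_divide_distrib
      by (intro sum.cong refl) (simp add: binomial_fact field_simps)
    also have "\<dots> = (1 + (-1)) ^ k / fact k"
      by (simp only: binomial_ring)
    finally show ?thesis
      by simp
  qed
  have "(\<lambda>k. (if k = 0 then 1 else 0) *\<^sub>R (A ^^ k) x) sums exp_op A (exp_op (\<lambda>x. - A x) x)"
    using op_series.power_series_op_mult[OF 1 2, of x]
    unfolding conv exp_minus[symmetric] exp_op_def[symmetric] .
  moreover have "(\<lambda>k. (if k = 0 then 1 else 0) *\<^sub>R (A ^^ k) x) sums x"
    using sums_single[of 0 "\<lambda>k. (A ^^ k) x"] by (simp add: if_distrib[of "\<lambda>r. r *\<^sub>R _"] cong: if_cong)
  ultimately show ?thesis
    by (rule sums_unique2)
qed

lemma exp_op_minus':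
  assumes A: "bounded_op_on UNIV A"
  shows "exp_op (\<lambda>x. - A x) (exp_op A x) = x"
  using exp_op_minus[OF bounded_op_on_compose[OF bounded_op_on_scaleC[OF closed_csubspace_UNIV, of "-1"] A]]
  by (simp add: scaleC_minus_one)

lemma exp_op_adjoint:
  assumes A: "bounded_op_on UNIV A" and B: "bounded_op_on UNIV B"
    and AB: "\<And>x y. cinner (A x) y = cinner x (B y)"
  shows "cinner (exp_op A x) y = cinner x (exp_op B y)"
proof -
  obtain K L where K: "0 \<le> K" "\<And>x. norm (A x) \<le> K * norm x" and L: "0 \<le> L" "\<And>x. norm (B x) \<le> L * norm x"
    using bounded_op_on_bound[OF A] bounded_op_on_bound[OF B] by blast
  let ?M = "max K L"
  have M: "norm (A x) \<le> ?M * norm x" "norm (B x) \<le> ?M * norm x" for x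
    using K(2)[of x] L(2)[of x] mult_right_mono[of K ?M "norm x"] mult_right_mono[of L ?M "norm x"]
    by auto
  have "summable (\<lambda>n. inverse (fact n) * ?M ^ n)"
    using summable_exp[of ?M] by simp
  then have "op_series (\<lambda>n. inverse (fact n)) A ?M" "op_series (\<lambda>n. inverse (fact n)) B ?M"
    using A B K(1) M by (unfold_locales; simp)+
  then show ?thesis
    unfolding exp_op_def by (rule op_series.power_series_op_adjoint[OF _ _ AB])
qed

text \<open>If \<open>A\<close> is normal with adjoint \<open>B\<close>, then \<open>exp A exp (- B)\<close> is an isometry: it is the exponential of the
skew-adjoint operator \<open>A - B\<close>. The proof moves the factors across the inner product one at a time and
cancels them in pairs by \<open>exp A exp (- A) = 1\<close>.\<close>

lemma norm_exp_op_exp_op_minus_adjoint: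
  assumes A: "bounded_op_on UNIV A" and B: "bounded_op_on UNIV B"
    and adj: "\<And>x y. cinner (A x) y = cinner x (B y)"
    and comm: "\<And>x. A (B x) = B (A x)"
  shows "norm (exp_op A (exp_op (\<lambda>x. - B x) x)) = norm x"
proof -
  note eA = bounded_op_exp_op[OF A] and eB = bounded_op_exp_op[OF B]
  have minus: "bounded_op_on UNIV (\<lambda>x. - A x)" "bounded_op_on UNIV (\<lambda>x. - B x)"
    using bounded_op_on_compose[OF bounded_op_on_scaleC[OF closed_csubspace_UNIV, of "-1"] A]
      bounded_op_on_compose[OF bounded_op_on_scaleC[OF closed_csubspace_UNIV, of "-1"] B]
    by (simp_all add: scaleC_minus_one)
  have BA: "exp_op B (exp_op A y) = exp_op A (exp_op B y)" for y
    by (rule exp_op_commute[OF B eA, symmetric, THEN sym]) (simp add: exp_op_commute[OF A B comm])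
  let ?y = "exp_op (\<lambda>x. - B x) x"
  have "cinner (exp_op A ?y) (exp_op A ?y) = cinner ?y (exp_op A (exp_op B ?y))"
    by (simp add: exp_op_adjoint[OF A B adj] BA)
  also have "\<dots> = cinner ?y (exp_op A x)"
    by (simp add: exp_op_minus[OF B])
  also have "\<dots> = cinner x (exp_op (\<lambda>x. - A x) (exp_op A x))"
  proof (rule exp_op_adjoint[OF minus(2) minus(1)])
    show "cinner (- B x) y = cinner x (- A y)" for x y
      using adj[of y x] cinner_commute[of "B x" y] cinner_commute[of x "A y"]
      by (simp add: cinner_minus_left cinner_minus_right)
  qed
  also have "\<dots> = cinner x x"
    by (simp add: exp_op_minus'[OF A])
  finally have "(norm (exp_op A ?y))\<^sup>2 = (norm x)\<^sup>2"
    by (simp only: cinner_self of_real_eq_iff)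
  then show ?thesis
    by simp
qed

text \<open>Rosenblum's proof. Let \<open>M = N\<^sup>*\<close>. The function \<open>f z = \<langle>exp (z M) T exp (- z M) x, y\<rangle>\<close> is entire, and its
derivative at 0 is \<open>\<langle>(M T - T M) x, y\<rangle>\<close>. Because \<open>T\<close> commutes with \<open>N\<close>, conjugating \<open>T\<close> by
\<open>exp (cnj z N)\<close> does not change it, so \<open>f\<close> can be rewritten with the isometries of the previous lemma on
both sides of \<open>T\<close>. Hence \<open>f\<close> is bounded, thus constant by Liouville's theorem, and the derivative is 0.\<close>

theorem fuglede:
  assumes N: "normal_on UNIV N" and T: "bounded_op_on UNIV T" and TN: "\<And>x. T (N x) = N (T x)"
  shows "T (adjoint_on UNIV N x) = adjoint_on UNIV N (T x)"
proof -
  define M where "M = adjoint_on UNIV N"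
  have bN: "bounded_op_on UNIV N" and MN: "M (N x) = N (M x)" for x
    using N by (auto simp: normal_on_def M_def)
  have bM: "bounded_op_on UNIV M"
    unfolding M_def by (rule bounded_op_on_adjoint[OF _ bN]) simp
  have adj: "cinner (N x) y = cinner x (M y)" "cinner (M x) y = cinner x (N y)" for x y
    using cinner_adjoint_on[OF _ bN, of y x] cinner_adjoint_on_left[OF _ bN, of y x] by (auto simp: M_def)
  obtain K where K: "0 \<le> K" "\<And>x. norm (T x) \<le> K * norm x"
    using bounded_op_on_bound[OF T] by blast
  have scale: "bounded_op_on UNIV (\<lambda>x. c *\<^sub>C A x)" if "bounded_op_on UNIV A" for c and A :: "'a \<Rightarrow> 'a"
    using bounded_op_on_compose[OF bounded_op_on_scaleC[OF closed_csubspace_UNIV, of c] that] .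
  have "cinner (T (M x) - M (T x)) y = 0" for x y
  proof -
    (* The left exponential is moved to the second argument, so that f is an inner product of two power series. *)
    define f where "f z = cinner (T (exp_op (\<lambda>x. (- z) *\<^sub>C M x) x)) (exp_op (\<lambda>x. cnj z *\<^sub>C N x) y)" for z
    define c where "c k = (\<Sum>i\<le>k. complex_of_real ((-1) ^ i * inverse (fact i) * inverse (fact (k - i)))
      * cinner (T ((M ^^ i) x)) ((N ^^ (k - i)) y))" for k
    have f_sums: "(\<lambda>k. c k * z ^ k) sums f z" for z
    proof -
      have pow: "((\<lambda>x. w *\<^sub>C A x) ^^ n) v = w ^ n *\<^sub>C (A ^^ n) v" if "bounded_op_on UNIV A"
        for w n v and A :: "'a \<Rightarrow> 'a"
        by (induction n) (auto simp: bounded_op_onD[OF that] scaleC_one scaleC_scaleC)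
      obtain K1 K2 where K1: "op_series (\<lambda>n. inverse (fact n)) (\<lambda>x. (- z) *\<^sub>C M x) K1"
        and K2: "op_series (\<lambda>n. inverse (fact n)) (\<lambda>x. cnj z *\<^sub>C N x) K2"
        using op_series_exp[OF scale[OF bM]] op_series_exp[OF scale[OF bN]] by metis
      (* Absorbing T into the product leaves two plain exponential series. *)
      have bil: "bounded_bilinear (\<lambda>u v. cinner (T u) v)"
        using bounded_bilinear.comp[OF bounded_bilinear_cinner bounded_op_on_imp_bounded_linear[OF T] bounded_linear_ident]
        by simp
      have "(\<lambda>k. \<Sum>i\<le>k. cinner (T (inverse (fact i) *\<^sub>R ((- z) ^ i *\<^sub>C (M ^^ i) x)))
          (inverse (fact (k - i)) *\<^sub>R (cnj z ^ (k - i) *\<^sub>C (N ^^ (k - i)) y))) sums f z"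
        using bounded_bilinear_Cauchy_product_sums[OF bil op_series.summable_norm[OF K1, of x] op_series.summable_norm[OF K2, of y]]
        unfolding pow[OF bM] pow[OF bN] f_def exp_op_def power_series_op_def by simp
      also have "(\<lambda>k. \<Sum>i\<le>k. cinner (T (inverse (fact i) *\<^sub>R ((- z) ^ i *\<^sub>C (M ^^ i) x)))
          (inverse (fact (k - i)) *\<^sub>R (cnj z ^ (k - i) *\<^sub>C (N ^^ (k - i)) y))) = (\<lambda>k. c k * z ^ k)"
      proof
        fix k
        show "(\<Sum>i\<le>k. cinner (T (inverse (fact i) *\<^sub>R ((- z) ^ i *\<^sub>C (M ^^ i) x)))
          (inverse (fact (k - i)) *\<^sub>R (cnj z ^ (k - i) *\<^sub>C (N ^^ (k - i)) y))) = c k * z ^ k"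
          unfolding c_def sum_distrib_right
        proof (rule sum.cong[OF refl])
          fix i assume "i \<in> {..k}"
          then have z: "z ^ k = z ^ i * z ^ (k - i)"
            by (simp flip: power_add)
          show "cinner (T (inverse (fact i) *\<^sub>R ((- z) ^ i *\<^sub>C (M ^^ i) x)))
            (inverse (fact (k - i)) *\<^sub>R (cnj z ^ (k - i) *\<^sub>C (N ^^ (k - i)) y)) =
            complex_of_real ((-1) ^ i * inverse (fact i) * inverse (fact (k - i)))
            * cinner (T ((M ^^ i) x)) ((N ^^ (k - i)) y) * z ^ k"
            unfolding z power_minus[of z]
            by (simp add: scaleR_scaleC bounded_op_onD[OF T] cinner_linear scaleC_scaleC)
        qed
      qed
      finally show ?thesis .
    qed
    have f_eq: "f = (\<lambda>z. suminf (\<lambda>k. c k * z ^ k))"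
      using f_sums by (simp add: sums_iff fun_eq_iff)
    have deriv: "(f has_field_derivative suminf (\<lambda>n. diffs c n * z ^ n)) (at z)" for z
      unfolding f_eq using f_sums by (intro termdiffs_strong_converges_everywhere) (auto simp: sums_iff)
    have "bounded (range f)"
      unfolding bounded_iff
    proof (intro exI ballI)
      fix w assume "w \<in> range f"
      then obtain z where w: "w = f z"
        by blast
      define A where "A = (\<lambda>x. z *\<^sub>C M x)"
      define B where "B = (\<lambda>x. cnj z *\<^sub>C N x)"
      have bA: "bounded_op_on UNIV A" and bB: "bounded_op_on UNIV B"
        unfolding A_def B_def by (rule scale bM bN)+
      have mA: "bounded_op_on UNIV (\<lambda>x. - A x)" and mB: "bounded_op_on UNIV (\<lambda>x. - B x)"
        using scale[OF bA, of "-1"] scale[OF bB, of "-1"] by (simp_all add: scaleC_minus_one)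
      have adjAB: "cinner (A u) v = cinner u (B v)" for u v
        by (simp_all add: A_def B_def cinner_linear adj)
      have comm: "A (B u) = B (A u)" for u
        by (simp add: A_def B_def bounded_op_onD[OF bM] bounded_op_onD[OF bN] MN scaleC_scaleC mult.commute)
      have TB: "- B (T u) = T (- B u)" for u
        using bounded_op_on_diff[OF closed_csubspace_UNIV T, of 0 "B u"] bounded_op_onD(3)[OF T, of 0 0]
        by (simp add: B_def bounded_op_onD[OF T] TN)
      let ?u = "exp_op (\<lambda>x. - A x) x"
      have mz: "(\<lambda>x. (- z) *\<^sub>C M x) = (\<lambda>x. - A x)"
        by (simp add: A_def fun_eq_iff scaleC_minus_left)
      have "f z = cinner (exp_op A (T ?u)) y"
        unfolding f_def mz B_def[symmetric] by (rule exp_op_adjoint[OF bA bB adjAB, symmetric])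
      also have "T ?u = T (exp_op (\<lambda>x. - B x) (exp_op B ?u))"
        by (simp add: exp_op_minus'[OF bB])
      also have "\<dots> = exp_op (\<lambda>x. - B x) (T (exp_op B ?u))"
        by (rule exp_op_commute[OF mB T TB, symmetric])
      finally have "cmod w \<le> norm (exp_op A (exp_op (\<lambda>x. - B x) (T (exp_op B ?u)))) * norm y"
        unfolding w by (simp add: cinner_Cauchy_Schwarz)
      also have "\<dots> = norm (T (exp_op B ?u)) * norm y"
        by (simp add: norm_exp_op_exp_op_minus_adjoint[OF bA bB adjAB comm])
      also have "\<dots> \<le> K * norm (exp_op B ?u) * norm y"
        by (intro mult_right_mono K) auto
      also have "norm (exp_op B ?u) = norm x"
      proof (rule norm_exp_op_exp_op_minus_adjoint[OF bB bA _ comm[symmetric]])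
        show "cinner (B u) v = cinner u (A v)" for u v
          by (simp add: A_def B_def cinner_linear adj)
      qed
      finally show "cmod w \<le> K * norm x * norm y" .
    qed
    moreover have "f holomorphic_on UNIV"
      using deriv by (auto simp: holomorphic_on_def field_differentiable_def)
    ultimately obtain a where a: "f = (\<lambda>_. a)"
      using Liouville_theorem[of f] by (auto simp: constant_on_def fun_eq_iff)
    have "suminf (\<lambda>n. diffs c n * 0 ^ n) = 0"
      using deriv[of 0] unfolding a by (intro DERIV_unique[OF _ DERIV_const])
    then have "c 1 = 0"
      by (simp add: powser_zero diffs_def)
    then show ?thesis
      by (simp add: c_def cinner_diff_left adj)
  qed
  then have "cinner (T (M x) - M (T x)) (T (M x) - M (T x)) = 0"
    by blast
  then show ?thesis
    by (simp add: cinner_self M_def)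
qed

section \<open>Numerical radius of normal operators\<close>

text \<open>Polarisation bounds \<open>|\<langle>T x, y\<rangle>|\<close> by \<open>\<parallel>x\<parallel>\<^sup>2 + \<parallel>y\<parallel>\<^sup>2\<close>; take for \<open>y\<close> the multiple of \<open>T x\<close> that has the norm
of \<open>x\<close>.\<close>

lemma norm_le_twice_numerical_radius:
  assumes S: "closed_csubspace S" and T: "bounded_op_on S T"
    and w: "\<And>x. x \<in> S \<Longrightarrow> cmod (cinner (T x) x) \<le> (norm x)\<^sup>2" and x: "x \<in> S"
  shows "norm (T x) \<le> 2 * norm x"
proof (cases "T x = 0")
  case False
  note S' = closed_csubspaceD[OF S] and lin = bounded_op_onD[OF T]
  have polar: "4 * cmod (cinner (T x) y) \<le> 4 * ((norm x)\<^sup>2 + (norm y)\<^sup>2)" if y: "y \<in> S" for y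
  proof -
    define q where "q c = cinner (T (x + c *\<^sub>C y)) (x + c *\<^sub>C y)" for c
    have bound: "cmod (c * q c) \<le> (norm (x + c *\<^sub>C y))\<^sup>2" if "cmod c = 1" for c
      using w[of "x + c *\<^sub>C y"] x y S' that by (simp add: q_def norm_mult)
    have "4 * cinner (T x) y = 1 * q 1 + (-1) * q (-1) + \<i> * q \<i> + (-\<i>) * q (-\<i>)"
      using x y S' by (simp add: q_def lin cinner_linear algebra_simps)
    then have "4 * cmod (cinner (T x) y) = cmod (1 * q 1 + (-1) * q (-1) + \<i> * q \<i> + (-\<i>) * q (-\<i>))"
      by (metis norm_mult norm_numeral)
    also have "\<dots> \<le> cmod (1 * q 1) + cmod ((-1) * q (-1)) + cmod (\<i> * q \<i>) + cmod ((-\<i>) * q (-\<i>))"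
      by (intro order_trans[OF norm_triangle_ineq] add_right_mono order_refl)
    also have "\<dots> \<le> (norm (x + 1 *\<^sub>C y))\<^sup>2 + (norm (x + (-1) *\<^sub>C y))\<^sup>2
        + (norm (x + \<i> *\<^sub>C y))\<^sup>2 + (norm (x + (-\<i>) *\<^sub>C y))\<^sup>2"
      by (intro add_mono bound) auto
    also have "\<dots> = 4 * ((norm x)\<^sup>2 + (norm y)\<^sup>2)"
      by (simp add: norm_add_sq norm_scaleC cinner_linear)
    finally show ?thesis .
  qed
  define r where "r = norm x / norm (T x)"
  have "cinner (T x) (r *\<^sub>R T x) = complex_of_real (norm x * norm (T x))"
    using False by (simp add: r_def scaleR_scaleC cinner_scaleC_right cinner_self power2_eq_square)
  then have "cmod (cinner (T x) (r *\<^sub>R T x)) = norm x * norm (T x)"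
    by (simp only: norm_of_real abs_mult abs_norm_cancel)
  moreover have "norm (r *\<^sub>R T x) = norm x"
    using False by (simp add: r_def)
  ultimately have "norm x * norm (T x) \<le> norm x * (2 * norm x)"
    using polar[of "r *\<^sub>R T x"] lin(1)[OF x] S' by (simp add: power2_eq_square)
  moreover have "x \<noteq> 0"
    using False lin(3)[OF x, of 0] by auto
  ultimately show ?thesis
    by simp
qed simp

text \<open>The case \<open>n = 2\<close> of Berger's power inequality. It rests on the identity
\<open>2 / (1 - t\<^sup>2) = 1 / (1 - t) + 1 / (1 + t)\<close>: for \<open>u = (1 + T) x\<close> and \<open>v = (1 - T) x\<close> one has
\<open>(1 - T) u = (1 - T\<^sup>2) x = (1 + T) v\<close> and \<open>u + v = 2 x\<close>, while \<open>1 - T\<close> and \<open>1 + T\<close> have nonnegative real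
part.\<close>

lemma Re_cinner_square_le:
  assumes S: "closed_csubspace S" and T: "bounded_op_on S T"
    and w: "\<And>x. x \<in> S \<Longrightarrow> cmod (cinner (T x) x) \<le> (norm x)\<^sup>2" and x: "x \<in> S"
  shows "Re (cinner (T (T x)) x) \<le> (norm x)\<^sup>2"
proof -
  note S' = closed_csubspaceD[OF S] and lin = bounded_op_onD[OF T]
  define u v where "u = x + T x" and "v = x - T x"
  have uv: "u \<in> S" "v \<in> S"
    using x S' lin(1)[OF x] by (auto simp: u_def v_def)
  have Tuv: "u - T u = x - T (T x)" "v + T v = x - T (T x)"
    using x lin(1)[OF x] by (simp_all add: u_def v_def lin bounded_op_on_diff[OF S T])
  have "0 \<le> Re (cinner (u - T u) u)" "0 \<le> Re (cinner (v + T v) v)"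
    using w[OF uv(1)] w[OF uv(2)] abs_Re_le_cmod[of "cinner (T u) u"] abs_Re_le_cmod[of "cinner (T v) v"]
    by (auto simp: cinner_linear cinner_self simp del: of_real_power)
  then have "0 \<le> Re (cinner (x - T (T x)) (u + v))"
    unfolding Tuv by (simp add: cinner_add_right)
  also have "u + v = 2 *\<^sub>R x"
    by (simp add: u_def v_def scaleR_2)
  finally show ?thesis
    by (simp add: cinner_linear scaleR_scaleC cinner_self del: of_real_power)
qed

text \<open>Replace \<open>T\<close> by \<open>d T\<close> with a unimodular \<open>d\<close> such that \<open>d\<^sup>2\<close> rotates \<open>\<langle>T\<^sup>2 x, x\<rangle>\<close> to its modulus.\<close>

lemma numerical_radius_square_le:
  assumes S: "closed_csubspace S" and T: "bounded_op_on S T"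
    and w: "\<And>x. x \<in> S \<Longrightarrow> cmod (cinner (T x) x) \<le> (norm x)\<^sup>2" and x: "x \<in> S"
  shows "cmod (cinner (T (T x)) x) \<le> (norm x)\<^sup>2"
proof -
  note S' = closed_csubspaceD[OF S] and lin = bounded_op_onD[OF T]
  obtain c where c: "cmod c = 1" "c * cinner (T (T x)) x = complex_of_real (cmod (cinner (T (T x)) x))"
    using exists_unimodular_rotation by blast
  define d where "d = csqrt c"
  have d: "d * d = c"
    by (metis d_def power2_csqrt power2_eq_square)
  then have "cmod d = 1"
    using c(1) by (metis norm_mult norm_ge_zero abs_of_nonneg abs_mult_self_eq mult_1_right
        power2_eq_square power2_eq_iff_nonneg zero_le_one)
  have "cmod (cinner (T (T x)) x) = Re (cinner (d *\<^sub>C T (d *\<^sub>C T x)) x)"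
    using lin(3)[OF lin(1)[OF x]] c(2) by (simp add: scaleC_scaleC d cinner_scaleC_left)
  also have "\<dots> \<le> (norm x)\<^sup>2"
    by (rule Re_cinner_square_le[OF S bounded_op_on_compose[OF bounded_op_on_scaleC[OF S] T] _ x])
      (use w \<open>cmod d = 1\<close> in \<open>simp add: cinner_scaleC_left norm_mult\<close>)
  finally show ?thesis .
qed

lemma normal_on_square:
  assumes S: "closed_csubspace S" and T: "normal_on S T"
  shows "normal_on S (\<lambda>x. T (T x))"
proof -
  have bT: "bounded_op_on S T" and comm: "\<And>x. x \<in> S \<Longrightarrow> adjoint_on S T (T x) = T (adjoint_on S T x)"
    using T by (auto simp: normal_on_def)
  note mem = bounded_op_onD(1)[OF bT] adjoint_on_mem[OF S bT]
  have "adjoint_on S (\<lambda>x. T (T x)) y = adjoint_on S T (adjoint_on S T y)" if "y \<in> S" for y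
    using that by (intro adjoint_on_eqI[OF S]) (simp_all add: mem cinner_adjoint_on[OF S bT])
  then show ?thesis
    using bounded_op_on_compose[OF bT bT] by (simp add: normal_on_def mem comm)
qed

lemma norm_adjoint_normal:
  assumes S: "closed_csubspace S" and T: "normal_on S T" and x: "x \<in> S"
  shows "norm (adjoint_on S T x) = norm (T x)"
proof -
  have bT: "bounded_op_on S T" and comm: "\<And>x. x \<in> S \<Longrightarrow> adjoint_on S T (T x) = T (adjoint_on S T x)"
    using T by (auto simp: normal_on_def)
  note mem = bounded_op_onD(1)[OF bT] adjoint_on_mem[OF S bT]
  have "cinner (adjoint_on S T x) (adjoint_on S T x) = cinner (T x) (T x)"
    using x by (simp add: cinner_adjoint_on_left[OF S bT] cinner_adjoint_on[OF S bT] mem comm)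
  then have "(norm (adjoint_on S T x))\<^sup>2 = (norm (T x))\<^sup>2"
    by (simp only: cinner_self of_real_eq_iff)
  then show ?thesis
    by simp
qed

text \<open>For normal \<open>T\<close> and \<open>\<parallel>x\<parallel> \<le> 1\<close>, \<open>\<parallel>T x\<parallel>\<^sup>2 = \<langle>T\<^sup>* T x, x\<rangle> \<le> \<parallel>T\<^sup>* T x\<parallel> = \<parallel>T\<^sup>2 x\<parallel>\<close>. Squaring preserves both
normality and the bound on the numerical radius, so iteration gives \<open>\<parallel>T x\<parallel> ^ 2\<^sup>n \<le> 2\<close> for every \<open>n\<close>, with
the constant 2 from polarisation.\<close>

lemma normal_norm_le_numerical_radius:
  assumes S: "closed_csubspace S" and T: "normal_on S T"
    and w: "\<And>x. x \<in> S \<Longrightarrow> cmod (cinner (T x) x) \<le> (norm x)\<^sup>2" and x: "x \<in> S"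
  shows "norm (T x) \<le> norm x"
proof -
  have pow: "norm (T x) ^ (2 ^ n) \<le> 2" if "x \<in> S" "norm x \<le> 1" "normal_on S T"
      "\<forall>x\<in>S. cmod (cinner (T x) x) \<le> (norm x)\<^sup>2" for n T x
    using that(3,4)
  proof (induction n arbitrary: T)
    case 0
    then show ?case
      using norm_le_twice_numerical_radius[OF S _ _ that(1), of T] that(2) by (simp add: normal_on_def)
  next
    case (Suc n)
    have bT: "bounded_op_on S T"
      using Suc.prems by (simp add: normal_on_def)
    note mem = bounded_op_onD(1)[OF bT that(1)]
    have "(norm (T x))\<^sup>2 = Re (cinner (T x) (T x))"
      by (simp add: cinner_self del: of_real_power)
    also have "\<dots> = Re (cinner x (adjoint_on S T (T x)))"
      by (simp add: cinner_adjoint_on[OF S bT mem that(1)])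
    also have "\<dots> \<le> norm x * norm (T (T x))"
      using Re_cinner_le norm_adjoint_normal[OF S Suc.prems(1) mem] by metis
    also have "\<dots> \<le> norm (T (T x))"
      using mult_right_mono[OF that(2), of "norm (T (T x))"] by simp
    finally have "((norm (T x))\<^sup>2) ^ (2 ^ n) \<le> norm (T (T x)) ^ (2 ^ n)"
      by (intro power_mono) auto
    also have "\<dots> \<le> 2"
      using Suc.IH[OF normal_on_square[OF S Suc.prems(1)]] numerical_radius_square_le[OF S bT] Suc.prems(2)
      by blast
    finally show ?case
      by (simp add: power_mult)
  qed
  have unit: "norm (T x) \<le> 1" if x: "x \<in> S" "norm x \<le> 1" for x
  proof (rule ccontr)
    assume "\<not> ?thesis"
    then have gt: "1 < norm (T x)"
      by simp
    then obtain n where "2 < norm (T x) ^ n"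
      using real_arch_pow by blast
    also have "\<dots> \<le> norm (T x) ^ (2 ^ n)"
      using gt by (intro power_increasing) (auto intro: less_imp_le less_exp)
    also have "\<dots> \<le> 2"
      using pow x T w by blast
    finally show False
      by simp
  qed
  have bT: "bounded_op_on S T"
    using T by (simp add: normal_on_def)
  show ?thesis
  proof (cases "x = 0")
    case True
    then show ?thesis
      using bounded_op_onD(3)[OF bT x, of 0] by simp
  next
    case False
    define r where "r = complex_of_real (1 / norm x)"
    have "norm (T (r *\<^sub>C x)) \<le> 1"
      using x False closed_csubspaceD[OF S] by (intro unit) (auto simp: norm_scaleC r_def norm_divide)
    then show ?thesis
      using False bounded_op_onD(3)[OF bT x, of r] by (simp add: norm_scaleC r_def norm_divide field_simps)
  qed
qed

lemma adjoint_on_commute: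
  assumes S: "closed_csubspace S" and F: "bounded_op_on S F" and G: "bounded_op_on S G"
    and FG: "\<And>x. x \<in> S \<Longrightarrow> F (G x) = G (F x)" and y: "y \<in> S"
  shows "adjoint_on S F (adjoint_on S G y) = adjoint_on S G (adjoint_on S F y)"
proof (rule cinner_ext_on[OF S])
  show "cinner x (adjoint_on S F (adjoint_on S G y)) = cinner x (adjoint_on S G (adjoint_on S F y))"
    if "x \<in> S" for x
    using that y by (simp add: cinner_adjoint_on[OF S F, symmetric] cinner_adjoint_on[OF S G, symmetric]
        adjoint_on_mem[OF S F] adjoint_on_mem[OF S G] bounded_op_onD(1)[OF F] bounded_op_onD(1)[OF G] FG)
qed (use y in \<open>simp_all add: adjoint_on_mem[OF S F] adjoint_on_mem[OF S G]\<close>)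

text \<open>Since \<open>\<langle>F\<^sup>* x, x\<rangle>\<close> is the conjugate of \<open>\<langle>F x, x\<rangle>\<close>, the operator \<open>F\<^sup>* + z G\<close> has numerical radius at most 1,
so it suffices that it is normal. In the products with its adjoint \<open>F + cnj z G\<^sup>*\<close> the mixed terms are
\<open>F\<^sup>* G\<^sup>*\<close> and \<open>G F\<close> or the same in the opposite order, and these agree because \<open>F\<close> and \<open>G\<close> commute.\<close>

lemma norm_adjoint_plus_scaleC_le:
  assumes S: "closed_csubspace S" and F: "normal_on S F" and G: "normal_on S G"
    and FG: "\<And>x. x \<in> S \<Longrightarrow> F (G x) = G (F x)"
    and num: "\<And>x. x \<in> S \<Longrightarrow> cmod (cinner (F x) x) + cmod (cinner (G x) x) \<le> (norm x)\<^sup>2"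
    and z: "cmod z \<le> 1" and s: "s \<in> S"
  shows "norm (adjoint_on S F s + z *\<^sub>C G s) \<le> norm s"
proof (rule normal_norm_le_numerical_radius[OF S _ _ s])
  let ?F = "adjoint_on S F" and ?G = "adjoint_on S G" and ?T = "\<lambda>x. adjoint_on S F x + z *\<^sub>C G x"
  have b: "bounded_op_on S F" "bounded_op_on S G"
    using F G by (simp_all add: normal_on_def)
  note bA = bounded_op_on_adjoint[OF S b(1)] bounded_op_on_adjoint[OF S b(2)]
  note S' = closed_csubspaceD[OF S]
  note mem = bounded_op_onD(1)[OF b(1)] bounded_op_onD(1)[OF b(2)]
    bounded_op_onD(1)[OF bA(1)] bounded_op_onD(1)[OF bA(2)]
  note lin = bounded_op_onD(2,3)[OF b(1)] bounded_op_onD(2,3)[OF b(2)]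
    bounded_op_onD(2,3)[OF bA(1)] bounded_op_onD(2,3)[OF bA(2)]
  have comm: "F (?F x) = ?F (F x)" "G (?G x) = ?G (G x)" "?F (?G x) = ?G (?F x)" if "x \<in> S" for x
    using F G that adjoint_on_commute[OF S b FG] by (simp_all add: normal_on_def)
  have bT: "bounded_op_on S ?T"
    by (rule bounded_op_on_add[OF S bA(1) bounded_op_on_compose[OF bounded_op_on_scaleC[OF S] b(2)]])
  have adjT: "adjoint_on S ?T y = F y + cnj z *\<^sub>C ?G y" if y: "y \<in> S" for y
  proof (rule adjoint_on_eqI[OF S])
    show "F y + cnj z *\<^sub>C ?G y \<in> S"
      using y by (intro S' mem)
    show "cinner (?T x) y = cinner x (F y + cnj z *\<^sub>C ?G y)" if "x \<in> S" for x
      using that y by (simp add: cinner_linear cinner_adjoint_on_left[OF S b(1)]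
          cinner_adjoint_on[OF S b(2)])
  qed
  show "normal_on S ?T"
    unfolding normal_on_def
  proof (intro conjI ballI bT)
    fix x assume x: "x \<in> S"
    then show "adjoint_on S ?T (?T x) = ?T (adjoint_on S ?T x)"
      by (simp add: adjT bounded_op_onD(1)[OF bT] mem S' lin scaleC_add_right scaleC_scaleC FG comm
          algebra_simps)
  qed
  show "cmod (cinner (?T x) x) \<le> (norm x)\<^sup>2" if x: "x \<in> S" for x
  proof -
    have "cinner (?F x) x = cnj (cinner (F x) x)"
      using cinner_adjoint_on_left[OF S b(1) x x] cinner_commute by metis
    then have "cmod (cinner (?T x) x) \<le> cmod (cinner (F x) x) + cmod z * cmod (cinner (G x) x)"
      using norm_triangle_ineq[of "cinner (?F x) x" "z * cinner (G x) x"]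
      by (simp add: cinner_linear norm_mult)
    also have "\<dots> \<le> cmod (cinner (F x) x) + 1 * cmod (cinner (G x) x)"
      by (intro add_left_mono mult_right_mono z) simp
    also have "\<dots> \<le> (norm x)\<^sup>2"
      using num[OF x] by simp
    finally show ?thesis .
  qed
qed

section \<open>The tetrablock and its contractions\<close>

lemma tetrablock_swap: "(x1, x2, x3) \<in> tetrablock \<longleftrightarrow> (x2, x1, x3) \<in> tetrablock"
proof -
  have "(b, a, c) \<in> tetrablock" if abc: "(a, b, c) \<in> tetrablock" for a b c
  proof -
    have "1 - b * z1 - a * z2 + c * z1 * z2 \<noteq> 0" if "cmod z1 \<le> 1" "cmod z2 \<le> 1" for z1 z2
    proof -
      have "1 - a * z2 - b * z1 + c * z2 * z1 \<noteq> 0"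
        using abc that by (simp add: tetrablock_def)
      then show ?thesis
        by (simp add: algebra_simps)
    qed
    then show ?thesis
      by (simp add: tetrablock_def)
  qed
  then show ?thesis
    by blast
qed

text \<open>Otherwise \<open>z\<^sub>1 = (1 - z x\<^sub>2) / (x\<^sub>1 - z x\<^sub>3)\<close> lies in the closed disc, and \<open>(z\<^sub>1, z)\<close> is a zero of the
polynomial that defines the tetrablock.\<close>

lemma tetrablock_less:
  assumes x: "(x1, x2, x3) \<in> tetrablock" and z: "cmod z \<le> 1"
  shows "cmod (x1 - z * x3) < cmod (1 - z * x2)"
proof (rule ccontr)
  assume *: "\<not> ?thesis"
  have nz: "1 - x1 * z1 - x2 * z + x3 * z1 * z \<noteq> 0" if "cmod z1 \<le> 1" for z1
    using x z that by (auto simp: tetrablock_def)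
  have "1 - z * x2 \<noteq> 0"
    using nz[of 0] by (simp add: mult.commute)
  then have "x1 - z * x3 \<noteq> 0"
    using * by auto
  moreover have "cmod ((1 - z * x2) / (x1 - z * x3)) \<le> 1"
    using * \<open>x1 - z * x3 \<noteq> 0\<close> by (simp add: norm_divide)
  ultimately show False
    using nz[of "(1 - z * x2) / (x1 - z * x3)"] by (simp add: field_simps)
qed

lemma closure_tetrablock_le:
  assumes x: "(x1, x2, x3) \<in> closure tetrablock" and z: "cmod z \<le> 1"
  shows "cmod (x1 - z * x3) \<le> cmod (1 - z * x2)"
proof -
  let ?C = "{p :: complex \<times> complex \<times> complex. cmod (fst p - z * snd (snd p)) \<le> cmod (1 - z * fst (snd p))}"
  have "closure tetrablock \<subseteq> ?C"
    using tetrablock_less[OF _ z]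
    by (intro closure_minimal closed_Collect_le continuous_intros) (auto intro: less_imp_le)
  then show ?thesis
    using x by auto
qed

text \<open>For \<open>x\<^sub>3\<close>, the inequalities at \<open>z = 1\<close> and \<open>z = -1\<close> give
\<open>|x\<^sub>1|\<^sup>2 + |x\<^sub>3|\<^sup>2 < 1 + |x\<^sub>2|\<^sup>2\<close> by the parallelogram law; add the same inequality with \<open>x\<^sub>1\<close> and \<open>x\<^sub>2\<close>
exchanged.\<close>

lemma tetrablock_coordinates:
  assumes x: "(x1, x2, x3) \<in> tetrablock"
  shows "cmod x2 \<le> 1" "cmod x3 \<le> 1"
proof -
  show "cmod x2 \<le> 1"
  proof (rule ccontr)
    assume "\<not> ?thesis"
    then have "x2 \<noteq> 0" "cmod (1 / x2) \<le> 1"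
      by (auto simp: norm_divide divide_le_eq)
    then show False
      using tetrablock_less[OF x, of "1 / x2"] by simp
  qed
  have norm2: "(cmod a)\<^sup>2 + (cmod b)\<^sup>2 < (cmod c)\<^sup>2 + (cmod d)\<^sup>2"
    if "cmod (a - b) < cmod (c - d)" "cmod (a + b) < cmod (c + d)" for a b c d
  proof -
    have par: "(cmod (a - b))\<^sup>2 + (cmod (a + b))\<^sup>2 = 2 * ((cmod a)\<^sup>2 + (cmod b)\<^sup>2)" for a b
      by (simp add: cmod_power2) (simp add: power2_eq_square algebra_simps)
    have "(cmod (a - b))\<^sup>2 < (cmod (c - d))\<^sup>2" "(cmod (a + b))\<^sup>2 < (cmod (c + d))\<^sup>2"
      using that by (auto intro: power_strict_mono)
    then have "2 * ((cmod a)\<^sup>2 + (cmod b)\<^sup>2) < 2 * ((cmod c)\<^sup>2 + (cmod d)\<^sup>2)"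
      unfolding par[symmetric] by (rule add_strict_mono)
    then show ?thesis
      by simp
  qed
  have "(cmod x1)\<^sup>2 + (cmod x3)\<^sup>2 < (cmod 1)\<^sup>2 + (cmod x2)\<^sup>2"
    by (rule norm2) (use tetrablock_less[OF x, of 1] tetrablock_less[OF x, of "-1"] in simp_all)
  moreover have "(cmod x2)\<^sup>2 + (cmod x3)\<^sup>2 < (cmod 1)\<^sup>2 + (cmod x1)\<^sup>2"
    by (rule norm2) (use x tetrablock_less[of x2 x1 x3 1] tetrablock_less[of x2 x1 x3 "-1"] in
        \<open>simp_all add: tetrablock_swap[of x2]\<close>)
  ultimately have "(cmod x3)\<^sup>2 < 1\<^sup>2"
    by simp
  then show "cmod x3 \<le> 1"
    using power2_less_imp_less[of "cmod x3" 1] by simp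
qed

lemma closure_tetrablock_coordinates:
  assumes x: "(x1, x2, x3) \<in> closure tetrablock"
  shows "cmod x2 \<le> 1" "cmod x3 \<le> 1"
proof -
  have "closure tetrablock \<subseteq> {p. cmod (fst (snd p)) \<le> 1} \<inter> {p. cmod (snd (snd p)) \<le> 1}"
    by (intro closure_minimal closed_Int closed_Collect_le continuous_intros)
      (auto dest: tetrablock_coordinates)
  then show "cmod x2 \<le> 1" "cmod x3 \<le> 1"
    using x by auto
qed

lemma zero_in_tetrablock: "(0, 0, 0) \<in> tetrablock"
  by (simp add: tetrablock_def)

lemma norm_le_opnorm_on:
  assumes T: "bounded_op_on UNIV T"
  shows "norm (T x) \<le> opnorm_on UNIV T * norm x"
proof (cases "x = 0")
  case True
  then show ?thesis
    using bounded_op_onD(3)[OF T, of 0 0] by simp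
next
  case False
  obtain K where K: "0 \<le> K" "\<And>x. norm (T x) \<le> K * norm x"
    using bounded_op_on_bound[OF T] by blast
  have bdd: "bdd_above ((\<lambda>x. norm (T x)) ` {x \<in> UNIV. norm x \<le> 1})"
  proof (rule bdd_aboveI2)
    show "norm (T x) \<le> K" if "x \<in> {x \<in> UNIV. norm x \<le> 1}" for x
      using K(2)[of x] mult_left_mono[of "norm x" 1 K] that K(1) by simp
  qed
  define r where "r = complex_of_real (1 / norm x)"
  have "norm (T (r *\<^sub>C x)) \<le> opnorm_on UNIV T"
    unfolding opnorm_on_def by (rule cSUP_upper[OF _ bdd]) (use False in \<open>simp add: norm_scaleC r_def norm_divide\<close>)
  then show ?thesis
    using False bounded_op_onD(3)[OF T, of x r] by (simp add: norm_scaleC r_def norm_divide field_simps)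
qed

lemma bounded_op_on_sum:
  assumes S: "closed_csubspace S" and A: "\<And>i. i \<in> I \<Longrightarrow> bounded_op_on S (A i)"
  shows "bounded_op_on S (\<lambda>x. \<Sum>i\<in>I. A i x)"
  using A
proof (induction I rule: infinite_finite_induct)
  case (insert i I)
  then show ?case
    using bounded_op_on_add[OF S, of "A i" "\<lambda>x. \<Sum>i\<in>I. A i x"] by simp
qed (use bounded_op_on_scaleC[OF S, of 0] in simp_all)

lemma bounded_op_poly3_op:
  assumes "bounded_op_on UNIV X1" "bounded_op_on UNIV X2" "bounded_op_on UNIV X3"
  shows "bounded_op_on UNIV (poly3_op p X1 X2 X3)"
  unfolding poly3_op_def[abs_def] case_prod_beta
  by (intro bounded_op_on_sum closed_csubspace_UNIV bounded_op_on_funpow assms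
      bounded_op_on_compose[OF bounded_op_on_scaleC[OF closed_csubspace_UNIV]]
      bounded_op_on_compose[of UNIV "X1 ^^ _"] bounded_op_on_compose[of UNIV "X2 ^^ _"])

lemma norm_poly3_op_le:
  assumes X: "tetrablock_contraction X1 X2 X3"
    and p: "\<And>x1 x2 x3. (x1, x2, x3) \<in> closure tetrablock \<Longrightarrow> cmod (poly3_eval p (x1, x2, x3)) \<le> b"
  shows "norm (poly3_op p X1 X2 X3 x) \<le> b * norm x"
proof -
  have "opnorm_on UNIV (poly3_op p X1 X2 X3) \<le> (SUP z\<in>closure tetrablock. cmod (poly3_eval p z))"
    using X by (simp add: tetrablock_contraction_def)
  also have "\<dots> \<le> b"
    using p zero_in_tetrablock closure_subset[of tetrablock] by (intro cSUP_least) auto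
  finally have "opnorm_on UNIV (poly3_op p X1 X2 X3) * norm x \<le> b * norm x"
    by (rule mult_right_mono) simp
  moreover have "norm (poly3_op p X1 X2 X3 x) \<le> opnorm_on UNIV (poly3_op p X1 X2 X3) * norm x"
    using X by (intro norm_le_opnorm_on bounded_op_poly3_op) (auto simp: tetrablock_contraction_def)
  ultimately show ?thesis
    by linarith
qed

text \<open>Enlarging the index set makes the two polynomials in a sum share one, so that evaluation becomes additive
term by term.\<close>

lemma poly3_eval_superset:
  assumes "finite M" "Poly_Mapping.keys p \<subseteq> M"
  shows "poly3_eval p (x1, x2, x3) =
    (\<Sum>(i, j, k)\<in>M. Poly_Mapping.lookup p (i, j, k) * x1 ^ i * x2 ^ j * x3 ^ k)"
  unfolding poly3_eval_def prod.case
  by (rule sum.mono_neutral_left[OF assms]) (auto simp: in_keys_iff)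

lemma poly3_op_superset:
  assumes "finite M" "Poly_Mapping.keys p \<subseteq> M"
  shows "poly3_op p X1 X2 X3 x =
    (\<Sum>(i, j, k)\<in>M. Poly_Mapping.lookup p (i, j, k) *\<^sub>C (X1 ^^ i) ((X2 ^^ j) ((X3 ^^ k) x)))"
  unfolding poly3_op_def
  by (rule sum.mono_neutral_left[OF assms]) (auto simp: in_keys_iff)

lemma poly3_eval_add: "poly3_eval (p + q) (x1, x2, x3) = poly3_eval p (x1, x2, x3) + poly3_eval q (x1, x2, x3)"
proof -
  let ?M = "Poly_Mapping.keys p \<union> Poly_Mapping.keys q"
  note eval = poly3_eval_superset[of ?M]
  show ?thesis
    using Poly_Mapping.keys_add[of p q]
    by (simp add: eval lookup_add case_prod_beta distrib_right sum.distrib)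
qed

lemma poly3_op_add: "poly3_op (p + q) X1 X2 X3 x = poly3_op p X1 X2 X3 x + poly3_op q X1 X2 X3 x"
proof -
  let ?M = "Poly_Mapping.keys p \<union> Poly_Mapping.keys q"
  note op = poly3_op_superset[of ?M]
  show ?thesis
    using Poly_Mapping.keys_add[of p q]
    by (simp add: op lookup_add case_prod_beta scaleC_add_left sum.distrib)
qed

lemma poly3_eval_single: "poly3_eval (Poly_Mapping.single (i, j, k) c) (x1, x2, x3) = c * x1 ^ i * x2 ^ j * x3 ^ k"
  using poly3_eval_superset[of "{(i, j, k)}" "Poly_Mapping.single (i, j, k) c"] by simp

lemma poly3_op_single: "poly3_op (Poly_Mapping.single (i, j, k) c) X1 X2 X3 x = c *\<^sub>C (X1 ^^ i) ((X2 ^^ j) ((X3 ^^ k) x))"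
  using poly3_op_superset[of "{(i, j, k)}" "Poly_Mapping.single (i, j, k) c" X1 X2 X3 x] by simp

lemma poly3_eval_sum: "poly3_eval (\<Sum>n<(N::nat). p n) (x1, x2, x3) = (\<Sum>n<N. poly3_eval (p n) (x1, x2, x3))"
  by (induction N) (simp_all add: poly3_eval_add, simp add: poly3_eval_def)

lemma poly3_op_sum: "poly3_op (\<Sum>n<(N::nat). p n) X1 X2 X3 x = (\<Sum>n<N. poly3_op (p n) X1 X2 X3 x)"
  by (induction N) (simp_all add: poly3_op_add, simp add: poly3_op_def)

text \<open>Exchanging the first two variables maps the tetrablock to itself and carries polynomials to polynomials,
so the two operators may be exchanged as well.\<close>

lemma tetrablock_contraction_swap:
  assumes X: "tetrablock_contraction X1 X2 X3"
  shows "tetrablock_contraction X2 X1 X3"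
proof -
  have comm: "X1 (X2 x) = X2 (X1 x)" for x
    using X by (simp add: tetrablock_contraction_def commute_on_def)
  define s :: "nat \<times> nat \<times> nat \<Rightarrow> nat \<times> nat \<times> nat" where "s = (\<lambda>(i, j, k). (j, i, k))"
  have s: "inj s" "s (i, j, k) = (j, i, k)" "s (s m) = m" for i j k m
    by (auto simp: s_def inj_def split: prod.splits)
  have "opnorm_on UNIV (poly3_op p X2 X1 X3) \<le> (SUP z\<in>closure tetrablock. cmod (poly3_eval p z))" for p
  proof -
    define q where "q = Poly_Mapping.map_key s p"
    have lookup: "Poly_Mapping.lookup q (i, j, k) = Poly_Mapping.lookup p (j, i, k)" for i j k
      unfolding q_def by (subst map_key.rep_eq[OF s(1)]) (simp add: s)
    have keys: "Poly_Mapping.keys q = s ` Poly_Mapping.keys p"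
      unfolding q_def keys_map_key[OF s(1)]
    proof (intro equalityI subsetI)
      fix m assume "m \<in> s -` Poly_Mapping.keys p"
      then show "m \<in> s ` Poly_Mapping.keys p"
        by (intro image_eqI[of m s "s m"]) (simp_all add: s(3))
    qed (auto simp: s(3))
    have inj: "inj_on s (Poly_Mapping.keys p)"
      using s(1) by (rule inj_on_subset) simp
    have eval: "poly3_eval q (x1, x2, x3) = poly3_eval p (x2, x1, x3)" for x1 x2 x3
      unfolding poly3_eval_def prod.case keys sum.reindex[OF inj]
      by (rule sum.cong[OF refl]) (auto simp: s lookup)
    have "(X2 ^^ i) ((X1 ^^ j) y) = (X1 ^^ j) ((X2 ^^ i) y)" for i j y
      by (rule funpow_commute_op, rule funpow_commute_op[symmetric], rule comm)
    then have op: "poly3_op q X1 X2 X3 = poly3_op p X2 X1 X3"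
      unfolding fun_eq_iff poly3_op_def keys sum.reindex[OF inj]
      by (intro allI sum.cong[OF refl]) (auto simp: s lookup)
    have swap: "(x2, x1, x3) \<in> closure tetrablock" if "(x1, x2, x3) \<in> closure tetrablock" for x1 x2 x3
    proof -
      let ?h = "\<lambda>x :: complex \<times> complex \<times> complex. (fst (snd x), fst x, snd (snd x))"
      have "?h ` closure tetrablock \<subseteq> closure (?h ` tetrablock)"
        by (intro image_closure_subset continuous_intros closed_closure closure_subset)
      moreover have "?h ` tetrablock \<subseteq> tetrablock"
        using tetrablock_swap by fastforce
      ultimately have "?h ` closure tetrablock \<subseteq> closure tetrablock"
        using closure_mono by blast
      then show ?thesis
        using that by force
    qed
    have "(\<lambda>z. cmod (poly3_eval q z)) ` closure tetrablock = (\<lambda>z. cmod (poly3_eval p z)) ` closure tetrablock"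
    proof (intro equalityI subsetI)
      fix r assume "r \<in> (\<lambda>z. cmod (poly3_eval q z)) ` closure tetrablock"
      then obtain x1 x2 x3 where "(x1, x2, x3) \<in> closure tetrablock" "r = cmod (poly3_eval q (x1, x2, x3))"
        by force
      then show "r \<in> (\<lambda>z. cmod (poly3_eval p z)) ` closure tetrablock"
        using eval[of x1 x2 x3] swap by (metis imageI)
    next
      fix r assume "r \<in> (\<lambda>z. cmod (poly3_eval p z)) ` closure tetrablock"
      then obtain x1 x2 x3 where "(x1, x2, x3) \<in> closure tetrablock" "r = cmod (poly3_eval p (x1, x2, x3))"
        by force
      then show "r \<in> (\<lambda>z. cmod (poly3_eval q z)) ` closure tetrablock"
        using eval[of x2 x1 x3] swap by (metis imageI)
    qed
    then show ?thesis
      using X unfolding tetrablock_contraction_def op[symmetric] by metis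
  qed
  then show ?thesis
    using X by (simp add: tetrablock_contraction_def commute_on_def)
qed

lemma tetrablock_contraction_coordinates:
  assumes X: "tetrablock_contraction X1 X2 X3"
  shows "norm (X2 x) \<le> norm x" "norm (X3 x) \<le> norm x"
  using norm_poly3_op_le[OF X, of "Poly_Mapping.single (0, 1, 0) 1" 1 x]
    norm_poly3_op_le[OF X, of "Poly_Mapping.single (0, 0, 1) 1" 1 x]
  by (auto simp: poly3_eval_single poly3_op_single scaleC_one closure_tetrablock_coordinates)

text \<open>The polynomials \<open>p\<^sub>n = (x\<^sub>1 - z x\<^sub>3) (1 + z x\<^sub>2 + \<dots> + (z x\<^sub>2)\<^sup>n\<^sup>-\<^sup>1)\<close> equal
\<open>(x\<^sub>1 - z x\<^sub>3) / (1 - z x\<^sub>2)\<close> times \<open>1 - (z x\<^sub>2)\<^sup>n\<close>, so \<open>|p\<^sub>n| \<le> 1 + |z|\<^sup>n\<close> on the closed tetrablock.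
Applying \<open>p\<^sub>n\<close> of the operators to \<open>y = (1 - z X\<^sub>2) x\<close> telescopes to \<open>(X\<^sub>1 - z X\<^sub>3) (1 - (z X\<^sub>2)\<^sup>n) x\<close>, and
\<open>(z X\<^sub>2)\<^sup>n\<close> tends to 0.\<close>

lemma tetrablock_contraction_disc:
  assumes X: "tetrablock_contraction X1 X2 X3" and z: "cmod z < 1"
  shows "norm (X1 x - z *\<^sub>C X3 x) \<le> norm (x - z *\<^sub>C X2 x)"
proof -
  have b: "bounded_op_on UNIV X1" "bounded_op_on UNIV X2" "bounded_op_on UNIV X3"
    and comm: "\<And>x. X2 (X3 x) = X3 (X2 x)"
    using X by (auto simp: tetrablock_contraction_def commute_on_def)
  define p :: "nat \<Rightarrow> poly3" where "p n = (\<Sum>k<n. Poly_Mapping.single (1, k, 0) (z ^ k) + Poly_Mapping.single (0, k, 1) (- (z ^ Suc k)))" for n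
  have bound: "cmod (poly3_eval (p n) (x1, x2, x3)) \<le> 1 + cmod z ^ n"
    if x: "(x1, x2, x3) \<in> closure tetrablock" for n x1 x2 x3
  proof -
    have "cmod (z * x2) < 1"
      using z closure_tetrablock_coordinates(1)[OF x] mult_mono[of "cmod z" "cmod z" "cmod x2" 1]
      by (simp add: norm_mult)
    then have pos: "0 < cmod (1 - z * x2)"
      by auto
    have "poly3_eval (p n) (x1, x2, x3) = (x1 - z * x3) * (\<Sum>k<n. (z * x2) ^ k)"
      by (simp add: p_def poly3_eval_sum poly3_eval_add poly3_eval_single sum_distrib_left
          power_mult_distrib algebra_simps)
    then have "poly3_eval (p n) (x1, x2, x3) * (1 - z * x2) = (x1 - z * x3) * (1 - (z * x2) ^ n)"
      by (simp add: one_diff_power_eq mult_ac)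
    then have "cmod (poly3_eval (p n) (x1, x2, x3)) * cmod (1 - z * x2)
        = cmod (x1 - z * x3) * cmod (1 - (z * x2) ^ n)"
      by (metis norm_mult)
    also have "\<dots> \<le> cmod (1 - z * x2) * (1 + cmod z ^ n)"
    proof (intro mult_mono)
      show "cmod (x1 - z * x3) \<le> cmod (1 - z * x2)"
        using closure_tetrablock_le[OF x] z by simp
      have "cmod (z * x2) ^ n \<le> cmod z ^ n"
        using closure_tetrablock_coordinates(1)[OF x]
        by (intro power_mono) (auto simp: norm_mult mult_left_le)
      then show "cmod (1 - (z * x2) ^ n) \<le> 1 + cmod z ^ n"
        using norm_triangle_ineq4[of 1 "(z * x2) ^ n"] by (simp add: norm_power)
    qed auto
    finally show ?thesis
      using pos by (simp add: mult.commute)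
  qed
  define y where "y = x - z *\<^sub>C X2 x"
  define w where "w n = (\<Sum>k<n. z ^ k *\<^sub>C (X2 ^^ k) y)" for n
  have w: "w n = x - z ^ n *\<^sub>C (X2 ^^ n) x" for n
  proof (induction n)
    case 0
    then show ?case
      by (simp add: w_def scaleC_one)
  next
    case (Suc n)
    have "w (Suc n) = w n + z ^ n *\<^sub>C (X2 ^^ n) y"
      by (simp add: w_def)
    also have "(X2 ^^ n) y = (X2 ^^ n) x - z *\<^sub>C (X2 ^^ Suc n) x"
      unfolding y_def using bounded_op_on_diff[OF closed_csubspace_UNIV bounded_op_on_funpow[OF b(2)]]
        bounded_op_onD(3)[OF bounded_op_on_funpow[OF b(2)]] by (simp add: funpow_swap1)
    finally show ?case
      unfolding Suc by (simp add: scaleC_diff_right scaleC_scaleC mult.commute)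
  qed
  have op: "poly3_op (p n) X1 X2 X3 y = X1 (w n) - z *\<^sub>C X3 (w n)" for n
  proof -
    have zero: "X1 0 = 0" "X3 0 = 0"
      using bounded_op_onD(3)[OF b(1), of 0 0] bounded_op_onD(3)[OF b(3), of 0 0] by auto
    have "X1 (w n) = (\<Sum>k<n. z ^ k *\<^sub>C X1 ((X2 ^^ k) y))" "X3 (w n) = (\<Sum>k<n. z ^ k *\<^sub>C X3 ((X2 ^^ k) y))"
      unfolding w_def
      by (induction n) (simp_all add: zero bounded_op_onD[OF b(1)] bounded_op_onD[OF b(3)])
    moreover have "z *\<^sub>C (\<Sum>k<n. z ^ k *\<^sub>C X3 ((X2 ^^ k) y)) = (\<Sum>k<n. z ^ Suc k *\<^sub>C X3 ((X2 ^^ k) y))"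
      by (induction n) (simp_all add: scaleC_add_right scaleC_scaleC)
    moreover have "(X2 ^^ k) (X3 y) = X3 ((X2 ^^ k) y)" for k
      by (rule funpow_commute_op[of X2 X3, OF comm])
    ultimately show ?thesis
      by (simp add: p_def poly3_op_sum poly3_op_add poly3_op_single scaleC_minus_left sum_subtractf)
  qed
  have "norm (X1 (w n) - z *\<^sub>C X3 (w n)) \<le> (1 + cmod z ^ n) * norm y" for n
    using norm_poly3_op_le[OF X bound, of n y] by (simp add: op)
  moreover have "(\<lambda>n. (1 + cmod z ^ n) * norm y) \<longlonglongrightarrow> (1 + 0) * norm y"
    by (intro tendsto_intros LIMSEQ_power_zero) (use z in simp)
  moreover have "(\<lambda>n. norm (X1 (w n) - z *\<^sub>C X3 (w n))) \<longlonglongrightarrow> norm (X1 x - z *\<^sub>C X3 x)"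
  proof -
    have "(\<lambda>n. z ^ n *\<^sub>C (X2 ^^ n) x) \<longlonglongrightarrow> 0"
    proof (rule Lim_null_comparison[OF always_eventually])
      have "norm ((X2 ^^ n) x) \<le> 1 ^ n * norm x" for n
        using tetrablock_contraction_coordinates(1)[OF X] by (intro norm_funpow_le) auto
      then show "\<forall>n. norm (z ^ n *\<^sub>C (X2 ^^ n) x) \<le> cmod z ^ n * norm x"
        by (simp add: norm_scaleC norm_power mult_left_mono)
      show "(\<lambda>n. cmod z ^ n * norm x) \<longlonglongrightarrow> 0"
        using z by (auto intro!: tendsto_mult_left_zero LIMSEQ_power_zero)
    qed
    then have "w \<longlonglongrightarrow> x"
      using tendsto_diff[OF tendsto_const[of x]] by (fastforce simp: w[abs_def])
    then show ?thesis
      by (intro tendsto_norm tendsto_diff tendsto_scaleC bounded_op_on_tendsto[OF closed_csubspace_UNIV b(1)]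
          bounded_op_on_tendsto[OF closed_csubspace_UNIV b(3)]) auto
  qed
  ultimately have "norm (X1 x - z *\<^sub>C X3 x) \<le> (1 + 0) * norm y"
    by (intro LIMSEQ_le) auto
  then show ?thesis
    by (simp add: y_def)
qed

lemma tetrablock_contraction_circle:
  assumes X: "tetrablock_contraction X1 X2 X3" and z: "cmod z = 1"
  shows "norm (X1 x - z *\<^sub>C X3 x) \<le> norm (x - z *\<^sub>C X2 x)"
proof -
  define t where "t n = complex_of_real (1 - inverse (real (Suc n))) * z" for n
  have "cmod (t n) < 1" for n
    by (simp add: t_def norm_mult z del: of_real_diff) (simp add: field_simps)
  then have le: "norm (X1 x - t n *\<^sub>C X3 x) \<le> norm (x - t n *\<^sub>C X2 x)" for n
    by (rule tetrablock_contraction_disc[OF X])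
  have "t \<longlonglongrightarrow> complex_of_real (1 - 0) * z"
    unfolding t_def by (intro tendsto_intros LIMSEQ_inverse_real_of_nat)
  then have t: "t \<longlonglongrightarrow> z"
    by simp
  have scale: "(\<lambda>n. t n *\<^sub>C v) \<longlonglongrightarrow> z *\<^sub>C v" for v :: 'a
  proof (rule Lim_null[THEN iffD2], rule Lim_null_comparison[OF always_eventually])
    show "\<forall>n. norm (t n *\<^sub>C v - z *\<^sub>C v) \<le> cmod (t n - z) * norm v"
      using scaleC_add_left[of "t _ - z" z v] by (simp flip: norm_scaleC)
    show "(\<lambda>n. cmod (t n - z) * norm v) \<longlonglongrightarrow> 0"
      using t by (auto intro!: tendsto_mult_left_zero simp: LIM_zero tendsto_norm_zero)
  qed
  have "(\<lambda>n. norm (X1 x - t n *\<^sub>C X3 x)) \<longlonglongrightarrow> norm (X1 x - z *\<^sub>C X3 x)"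
    "(\<lambda>n. norm (x - t n *\<^sub>C X2 x)) \<longlonglongrightarrow> norm (x - z *\<^sub>C X2 x)"
    by (intro tendsto_norm tendsto_diff tendsto_const scale)+
  then show ?thesis
    by (rule LIMSEQ_le) (use le in blast)
qed

section \<open>Factoring operators through a positive operator\<close>

lemma bounded_op_on_subset:
  assumes T: "bounded_op_on UNIV T" and S: "\<And>x. x \<in> S \<Longrightarrow> T x \<in> S"
  shows "bounded_op_on S T"
proof -
  obtain K where "\<forall>x. norm (T x) \<le> K * norm x"
    using bounded_op_on_bound[OF T] by blast
  then show ?thesis
    by (intro bounded_op_onI[where K = K] S) (simp_all add: bounded_op_onD[OF T])
qed

lemma closure_range_sequence:
  fixes D :: "'b \<Rightarrow> 'a::metric_space"
  assumes "x \<in> closure (range D)"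
  obtains a where "(\<lambda>n. D (a n)) \<longlonglongrightarrow> x"
proof -
  obtain f where f: "\<forall>n. f n \<in> range D" "f \<longlonglongrightarrow> x"
    using iffD1[OF closure_sequential assms] by blast
  have "f n = D (inv D (f n))" for n
    using f(1) by (simp add: f_inv_into_f)
  then have "f = (\<lambda>n. D (inv D (f n)))"
    by (rule ext)
  then show ?thesis
    using that[of "\<lambda>n. inv D (f n)"] f(2) by simp
qed

lemma closure_range_limit:
  fixes D :: "'b \<Rightarrow> 'a::metric_space"
  shows "(\<lambda>n. D (a n)) \<longlonglongrightarrow> x \<Longrightarrow> x \<in> closure (range D)"
  unfolding closure_sequential by (rule exI[of _ "\<lambda>n. D (a n)"]) simp

lemma closed_csubspace_closure_range:
  assumes D: "bounded_op_on UNIV D"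
  shows "closed_csubspace (closure (range D))"
proof -
  have lin: "D (x + y) = D x + D y" "D (c *\<^sub>C x) = c *\<^sub>C D x" for c x y
    by (simp_all add: bounded_op_onD[OF D])
  have add: "x + y \<in> closure (range D)" if x: "x \<in> closure (range D)" and y: "y \<in> closure (range D)" for x y
  proof -
    obtain a b where "(\<lambda>n. D (a n)) \<longlonglongrightarrow> x" "(\<lambda>n. D (b n)) \<longlonglongrightarrow> y"
      by (rule closure_range_sequence[OF x], rule closure_range_sequence[OF y])
    then have "(\<lambda>n. D (a n + b n)) \<longlonglongrightarrow> x + y"
      unfolding lin(1) by (rule tendsto_add)
    then show ?thesis
      by (rule closure_range_limit)
  qed
  have scale: "c *\<^sub>C x \<in> closure (range D)" if x: "x \<in> closure (range D)" for c x
  proof -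
    obtain a where "(\<lambda>n. D (a n)) \<longlonglongrightarrow> x"
      by (rule closure_range_sequence[OF x])
    then have "(\<lambda>n. D (c *\<^sub>C a n)) \<longlonglongrightarrow> c *\<^sub>C x"
      unfolding lin(2) by (rule tendsto_scaleC)
    then show ?thesis
      by (rule closure_range_limit)
  qed
  have "D 0 = 0"
    using lin(2)[of 0 0] by simp
  then have "0 \<in> closure (range D)"
    using closure_subset by (metis rangeI subsetD)
  then show ?thesis
    using add scale by (simp add: closed_csubspace_def)
qed

locale positive_sandwich =
  fixes D :: "'a::chilbert_space \<Rightarrow> 'a"
  assumes positive: "positive_op D"
begin

abbreviation S :: "'a set"
  where "S \<equiv> closure (range D)"

lemma bounded: "bounded_op_on UNIV D"
  using positive by (simp add: positive_op_def)

lemma S: "closed_csubspace S"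
  by (rule closed_csubspace_closure_range[OF bounded])

lemma D_mem [simp]: "D x \<in> S"
  by (rule subsetD[OF closure_subset rangeI])

lemma self_adjoint: "cinner (D x) y = cinner x (D y)"
  by (rule positive_op_self_adjoint[OF positive])

text \<open>A vector killed by \<open>D\<close> is orthogonal to the range of \<open>D\<close>, hence to its closure.\<close>

lemma injective:
  assumes s: "s \<in> S" and "D s = 0" shows "s = 0"
proof -
  obtain a where a: "(\<lambda>n. D (a n)) \<longlonglongrightarrow> s"
    by (rule closure_range_sequence[OF s])
  have "cinner s (D (a n)) = 0" for n
    using self_adjoint[of s "a n"] \<open>D s = 0\<close> by simp
  then have "(\<lambda>n. 0) \<longlonglongrightarrow> cinner s s"
    using tendsto_cinner[OF tendsto_const a, of s] by simp
  then have "cinner s s = 0"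
    using LIMSEQ_unique tendsto_const by blast
  then show ?thesis
    by (simp add: cinner_self)
qed

lemma ext:
  assumes F: "bounded_op_on S F" and G: "bounded_op_on S G" and eq: "\<And>x. F (D x) = G (D x)"
    and s: "s \<in> S"
  shows "F s = G s"
proof -
  obtain a where a: "(\<lambda>n. D (a n)) \<longlonglongrightarrow> s"
    by (rule closure_range_sequence[OF s])
  have "(\<lambda>n. F (D (a n))) \<longlonglongrightarrow> F s" "(\<lambda>n. G (D (a n))) \<longlonglongrightarrow> G s"
    by (rule bounded_op_on_tendsto[OF S F D_mem s a] bounded_op_on_tendsto[OF S G D_mem s a])+
  then show ?thesis
    unfolding eq by (rule LIMSEQ_unique)
qed

lemma bounded_on_S: "bounded_op_on S D"
  by (rule bounded_op_on_subset[OF bounded]) (rule D_mem)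

text \<open>\<open>B\<close> has the factorisation \<open>B = D F D\<close> and commutes with \<open>D\<close>; for the defect operator, the fundamental operators
are the middle factors.\<close>

definition sandwich :: "('a \<Rightarrow> 'a) \<Rightarrow> ('a \<Rightarrow> 'a) \<Rightarrow> bool"
  where "sandwich F B \<longleftrightarrow> bounded_op_on S F \<and> bounded_op_on UNIV B \<and>
    (\<forall>x. D (F (D x)) = B x) \<and> (\<forall>x. D (B x) = B (D x))"

lemma sandwichD:
  assumes "sandwich F B"
  shows "bounded_op_on S F" "bounded_op_on UNIV B" "D (F (D x)) = B x" "D (B x) = B (D x)"
proof -
  note * = assms[unfolded sandwich_def]
  show "bounded_op_on S F" "bounded_op_on UNIV B" "D (F (D x)) = B x" "D (B x) = B (D x)"
    by (rule conjunct1[OF *], rule conjunct1[OF conjunct2[OF *]],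
        rule spec[OF conjunct1[OF conjunct2[OF conjunct2[OF *]]]],
        rule spec[OF conjunct2[OF conjunct2[OF conjunct2[OF *]]]])
qed

text \<open>\<open>D (F D) D = B D = D B = D (D F) D\<close>, and the outer factors \<open>D\<close> can be cancelled: the left one by
injectivity on \<open>S\<close>, the right one by density of the range.\<close>

lemma sandwich_commute_D:
  assumes F: "sandwich F B" and s: "s \<in> S"
  shows "F (D s) = D (F s)"
proof -
  note bF = sandwichD(1)[OF F] and FB = sandwichD(3)[OF F] and DB = sandwichD(4)[OF F]
  show ?thesis
  proof (rule ext[OF bounded_op_on_compose[OF bF bounded_on_S] bounded_op_on_compose[OF bounded_on_S bF] _ s])
    fix x
    have "D (F (D (D x)) - D (F (D x))) = 0"
      by (simp only: bounded_op_on_diff[OF closed_csubspace_UNIV bounded UNIV_I UNIV_I] FB DB diff_self)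
    then have "F (D (D x)) - D (F (D x)) = 0"
      by (rule injective[OF closed_csubspaceD(5)[OF S bounded_op_onD(1)[OF bF D_mem] D_mem]])
    then show "F (D (D x)) = D (F (D x))"
      by simp
  qed
qed

text \<open>Since \<open>F\<close> and \<open>G\<close> commute with \<open>D\<close>, \<open>D\<^sup>3 F G D = (D F D) (D G D) = B C\<close>, which is symmetric in the
two operators; cancel \<open>D\<^sup>3\<close> on the left and \<open>D\<close> on the right.\<close>

lemma sandwich_commute:
  assumes F: "sandwich F B" and G: "sandwich G C" and BC: "\<And>x. B (C x) = C (B x)" and s: "s \<in> S"
  shows "F (G s) = G (F s)"
proof -
  note b = sandwichD(1)[OF F] sandwichD(1)[OF G] and FB = sandwichD(3)[OF F] sandwichD(3)[OF G]
  note mem = bounded_op_onD(1)[OF b(1)] bounded_op_onD(1)[OF b(2)]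
  have cube: "D (D (D (H u))) = D (H (D (D u)))" if H: "sandwich H A" and u: "u \<in> S" for H A u
    by (simp only: sandwich_commute_D[OF H u, symmetric] sandwich_commute_D[OF H D_mem, symmetric])
  show ?thesis
  proof (rule ext[OF bounded_op_on_compose[OF b] bounded_op_on_compose[OF b(2,1)] _ s])
    fix x
    have "D (D (D (F (G (D x))))) = D (D (D (G (F (D x)))))"
      by (simp only: cube[OF F mem(2)[OF D_mem]] cube[OF G mem(1)[OF D_mem]] FB BC)
    then have "D (D (D (F (G (D x)) - G (F (D x))))) = 0"
      by (simp only: bounded_op_on_diff[OF closed_csubspace_UNIV bounded UNIV_I UNIV_I] diff_self)
    then have "F (G (D x)) - G (F (D x)) = 0"
      by (rule injective[OF closed_csubspaceD(5)[OF S mem(1)[OF mem(2)[OF D_mem]] mem(2)[OF mem(1)[OF D_mem]]]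
            injective[OF D_mem injective[OF D_mem]]])
    then show "F (G (D x)) = G (F (D x))"
      by simp
  qed
qed

lemma sandwich_adjoint:
  assumes F: "sandwich F B"
  shows "sandwich (adjoint_on S F) (adjoint_on UNIV B)"
proof -
  note b = sandwichD(1,2)[OF F] and FB = sandwichD(3)[OF F] and DB = sandwichD(4)[OF F]
  note adj = cinner_adjoint_on[OF S b(1)] cinner_adjoint_on[OF closed_csubspace_UNIV b(2) UNIV_I UNIV_I]
  have "D (adjoint_on S F (D y)) = adjoint_on UNIV B y" for y
  proof (rule cinner_eqI)
    fix x
    have "cinner x (D (adjoint_on S F (D y))) = cinner (D (F (D x))) y"
      by (simp only: self_adjoint[symmetric, of x] adj(1)[OF D_mem D_mem, symmetric] self_adjoint[of "F (D x)"])
    then show "cinner x (D (adjoint_on S F (D y))) = cinner x (adjoint_on UNIV B y)"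
      by (simp only: FB adj(2))
  qed
  moreover have "D (adjoint_on UNIV B y) = adjoint_on UNIV B (D y)" for y
  proof (rule cinner_eqI)
    fix x
    have "cinner x (D (adjoint_on UNIV B y)) = cinner (B (D x)) y"
      by (simp only: self_adjoint[symmetric, of x] adj(2))
    also have "\<dots> = cinner (B x) (D y)"
      by (simp only: DB[symmetric] self_adjoint)
    finally show "cinner x (D (adjoint_on UNIV B y)) = cinner x (adjoint_on UNIV B (D y))"
      by (simp only: adj(2))
  qed
  ultimately show ?thesis
    unfolding sandwich_def by (blast intro: bounded_op_on_adjoint S closed_csubspace_UNIV b)
qed

lemma sandwich_cinner:
  assumes F: "sandwich F B" shows "cinner (F (D x)) (D x) = cinner (B x) x"
  using self_adjoint[of "F (D x)" x] unfolding sandwichD(3)[OF F] by (rule sym)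

lemma sandwich_numerical_range:
  assumes F: "sandwich F B" and G: "sandwich G C"
    and BC: "\<And>y. cmod (cinner (B y) y) + cmod (cinner (C y) y) \<le> (norm (D y))\<^sup>2" and s: "s \<in> S"
  shows "cmod (cinner (F s) s) + cmod (cinner (G s) s) \<le> (norm s)\<^sup>2"
proof -
  obtain a where a: "(\<lambda>n. D (a n)) \<longlonglongrightarrow> s"
    by (rule closure_range_sequence[OF s])
  have "(\<lambda>n. cmod (cinner (F (D (a n))) (D (a n))) + cmod (cinner (G (D (a n))) (D (a n))))
      \<longlonglongrightarrow> cmod (cinner (F s) s) + cmod (cinner (G s) s)"
    by (intro tendsto_add tendsto_norm tendsto_cinner a bounded_op_on_tendsto[OF S sandwichD(1)[OF F] D_mem s a]
        bounded_op_on_tendsto[OF S sandwichD(1)[OF G] D_mem s a])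
  moreover have "(\<lambda>n. (norm (D (a n)))\<^sup>2) \<longlonglongrightarrow> (norm s)\<^sup>2"
    by (intro tendsto_power tendsto_norm a)
  ultimately show ?thesis
    by (rule LIMSEQ_le) (use BC in \<open>auto simp: sandwich_cinner[OF F] sandwich_cinner[OF G]\<close>)
qed

end

section \<open>The fundamental operators\<close>

text \<open>The square of the inequality on the circle, rearranged; the quadratic terms do not depend on \<open>z\<close>.\<close>

lemma tetrablock_contraction_Re_le:
  assumes X: "tetrablock_contraction X1 X2 X3" and z: "cmod z = 1"
  shows "2 * Re (z * cinner (X2 y - adjoint_on UNIV X1 (X3 y)) y)
    \<le> (norm y)\<^sup>2 + (norm (X2 y))\<^sup>2 - (norm (X1 y))\<^sup>2 - (norm (X3 y))\<^sup>2"
proof -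
  have b: "bounded_op_on UNIV X1"
    using X by (simp add: tetrablock_contraction_def)
  have adj: "cinner (adjoint_on UNIV X1 u) v = cinner u (X1 v)" for u v
    by (rule cinner_adjoint_on_left[OF closed_csubspace_UNIV b UNIV_I UNIV_I])
  have "(norm (X1 y - z *\<^sub>C X3 y))\<^sup>2 \<le> (norm (y - z *\<^sub>C X2 y))\<^sup>2"
    by (intro power_mono tetrablock_contraction_circle[OF X z]) simp
  moreover have "Re (cinner (X1 y) (z *\<^sub>C X3 y)) = Re (z * cinner (X3 y) (X1 y))"
    by (subst Re_cinner_commute) (simp add: cinner_scaleC_left)
  moreover have "Re (cinner y (z *\<^sub>C X2 y)) = Re (z * cinner (X2 y) y)"
    by (subst Re_cinner_commute) (simp add: cinner_scaleC_left)
  ultimately show ?thesis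
    by (simp add: norm_diff_sq norm_scaleC z cinner_diff_left adj right_diff_distrib)
qed

text \<open>Choose \<open>z\<close> and \<open>w\<close> so that both real parts become moduli, and add the previous inequality for
\<open>(X\<^sub>1, X\<^sub>2, X\<^sub>3)\<close> to the one for \<open>(X\<^sub>2, X\<^sub>1, X\<^sub>3)\<close>.\<close>

lemma tetrablock_contraction_numerical_range:
  assumes X: "tetrablock_contraction X1 X2 X3"
  shows "cmod (cinner (X1 y - adjoint_on UNIV X2 (X3 y)) y) + cmod (cinner (X2 y - adjoint_on UNIV X1 (X3 y)) y)
    \<le> (norm y)\<^sup>2 - (norm (X3 y))\<^sup>2"
proof -
  let ?a = "cinner (X1 y - adjoint_on UNIV X2 (X3 y)) y" and ?b = "cinner (X2 y - adjoint_on UNIV X1 (X3 y)) y"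
  obtain w z where w: "cmod w = 1" "w * ?a = complex_of_real (cmod ?a)"
    and z: "cmod z = 1" "z * ?b = complex_of_real (cmod ?b)"
    using exists_unimodular_rotation by metis
  have "2 * cmod ?b \<le> (norm y)\<^sup>2 + (norm (X2 y))\<^sup>2 - (norm (X1 y))\<^sup>2 - (norm (X3 y))\<^sup>2"
    using tetrablock_contraction_Re_le[OF X z(1), of y] unfolding z(2) by simp
  moreover have "2 * cmod ?a \<le> (norm y)\<^sup>2 + (norm (X1 y))\<^sup>2 - (norm (X2 y))\<^sup>2 - (norm (X3 y))\<^sup>2"
    using tetrablock_contraction_Re_le[OF tetrablock_contraction_swap[OF X] w(1), of y] unfolding w(2) by simp
  ultimately show ?thesis
    by simp
qed

theorem proposition4p17:
  fixes X1 X2 X3 F1 F2 :: "'h::chilbert_space \<Rightarrow> 'h"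
  assumes "tetrablock_contraction X1 X2 X3"
    and "normal_on UNIV X1" and "normal_on UNIV X2" and "normal_on UNIV X3"
    and "fundamental_operators X1 X2 X3 F1 F2"
  shows "commute_on (defect_space X3) F1 F2
    \<and> normal_on (defect_space X3) F1 \<and> normal_on (defect_space X3) F2
    \<and> (SUP z\<in>cball (0::complex) 1.
         opnorm_on (defect_space X3) (\<lambda>x. adjoint_on (defect_space X3) F1 x + z *\<^sub>C F2 x)) \<le> 1"
proof -
  note X = assms(1) and n1 = assms(2) and n2 = assms(3) and n3 = assms(4)
  note U = closed_csubspace_UNIV
  define A1 A2 A3 where "A1 = adjoint_on UNIV X1" and "A2 = adjoint_on UNIV X2" and "A3 = adjoint_on UNIV X3"
  have b: "bounded_op_on UNIV X1" "bounded_op_on UNIV X2" "bounded_op_on UNIV X3"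
    and c: "\<And>x. X2 (X1 x) = X1 (X2 x)" "\<And>x. X3 (X1 x) = X1 (X3 x)" "\<And>x. X3 (X2 x) = X2 (X3 x)"
    using X unfolding tetrablock_contraction_def commute_on_def by simp_all
  have bA: "bounded_op_on UNIV A1" "bounded_op_on UNIV A2" "bounded_op_on UNIV A3"
    unfolding A1_def A2_def A3_def
    by (rule bounded_op_on_adjoint[OF U b(1)] bounded_op_on_adjoint[OF U b(2)] bounded_op_on_adjoint[OF U b(3)])+

  (* Each rule moves the operators into the order X1, X2, X3, A1, A2, A3, so rewriting with them terminates. *)
  have nc: "A1 (X1 x) = X1 (A1 x)" "A2 (X2 x) = X2 (A2 x)" "A3 (X3 x) = X3 (A3 x)" for x
    using n1 n2 n3 unfolding normal_on_def A1_def A2_def A3_def by simp_all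
  note f1 = fuglede[OF n1, folded A1_def] and f2 = fuglede[OF n2, folded A2_def]
    and f3 = fuglede[OF n3, folded A3_def]
  have fc: "A1 (X2 x) = X2 (A1 x)" "A1 (X3 x) = X3 (A1 x)" "A2 (X1 x) = X1 (A2 x)"
    "A2 (X3 x) = X3 (A2 x)" "A3 (X1 x) = X1 (A3 x)" "A3 (X2 x) = X2 (A3 x)" for x
    by (rule f1[OF b(2) c(1), symmetric], rule f1[OF b(3) c(2), symmetric],
        rule f2[OF b(1) c(1)[symmetric], symmetric], rule f2[OF b(3) c(3), symmetric],
        rule f3[OF b(1) c(2)[symmetric], symmetric], rule f3[OF b(2) c(3)[symmetric], symmetric])
  have fa: "A2 (A1 x) = A1 (A2 x)" "A3 (A1 x) = A1 (A3 x)" "A3 (A2 x) = A2 (A3 x)" for x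
    by (rule f1[OF bA(2) fc(3)], rule f1[OF bA(3) fc(5)], rule f2[OF bA(3) fc(6)])
  note comm = c nc fc fa
  note adj = cinner_adjoint_on[OF U b(1) UNIV_I UNIV_I, folded A1_def]
    cinner_adjoint_on[OF U b(2) UNIV_I UNIV_I, folded A2_def]
    cinner_adjoint_on_left[OF U b(1) UNIV_I UNIV_I, folded A1_def]
    cinner_adjoint_on_left[OF U b(2) UNIV_I UNIV_I, folded A2_def]
    cinner_adjoint_on_left[OF U b(3) UNIV_I UNIV_I, folded A3_def]
    cinner_adjoint_on[OF U b(3) UNIV_I UNIV_I, folded A3_def]
  note lin = bounded_op_on_diff[OF U b(1)] bounded_op_on_diff[OF U b(2)] bounded_op_on_diff[OF U b(3)]
    bounded_op_on_diff[OF U bA(1)] bounded_op_on_diff[OF U bA(2)] bounded_op_on_diff[OF U bA(3)]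

  define D where "D = defect_op X3"
  note D = defect_op[OF b(3) tetrablock_contraction_coordinates(2)[OF X], folded D_def A3_def]
  have DX: "D (X1 x) = X1 (D x)" "D (X2 x) = X2 (D x)" "D (X3 x) = X3 (D x)"
    "D (A1 x) = A1 (D x)" "D (A2 x) = A2 (D x)" for x
    by (rule D(3)[OF b(1)], simp_all only: comm, rule D(3)[OF b(2)], simp_all only: comm,
        rule D(3)[OF b(3)], simp_all only: comm, rule D(3)[OF bA(1)], simp_all only: comm,
        rule D(3)[OF bA(2)], simp_all only: comm)
  interpret positive_sandwich D
    by standard (rule D(1))
  have S_eq: "defect_space X3 = S"
    by (simp add: defect_space_def D_def)

  define B1 where "B1 x = X1 x - A2 (X3 x)" for x
  define B2 where "B2 x = X2 x - A1 (X3 x)" for x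
  have bB: "bounded_op_on UNIV B1" "bounded_op_on UNIV B2"
    unfolding B1_def[abs_def] B2_def[abs_def]
    by (rule bounded_op_on_diff_op[OF U b(1) bounded_op_on_compose[OF bA(2) b(3)]],
        rule bounded_op_on_diff_op[OF U b(2) bounded_op_on_compose[OF bA(1) b(3)]])
  have F: "bounded_op_on S F1" "bounded_op_on S F2" "D (F1 (D x)) = B1 x" "D (F2 (D x)) = B2 x" for x
    using assms(5)[unfolded fundamental_operators_def S_eq, folded D_def A1_def A2_def]
    by (simp_all add: B1_def B2_def)
  have DB: "D (B1 x) = B1 (D x)" "D (B2 x) = B2 (D x)" for x
    by (simp_all add: B1_def B2_def bounded_op_on_diff[OF U bounded UNIV_I UNIV_I] DX)
  have sw: "sandwich F1 B1" "sandwich F2 B2"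
    unfolding sandwich_def by (intro conjI allI F bB DB)+
  define C1 C2 where "C1 = adjoint_on UNIV B1" and "C2 = adjoint_on UNIV B2"
  have C: "C1 y = A1 y - A3 (X2 y)" "C2 y = A2 y - A3 (X1 y)" for y
    unfolding C1_def C2_def
    by (rule adjoint_on_eqI[OF U]; simp add: B1_def B2_def cinner_linear adj)+
  have BC: "B1 (B2 x) = B2 (B1 x)" "B1 (C1 x) = C1 (B1 x)" "B2 (C2 x) = C2 (B2 x)" for x
    by (simp_all add: C B1_def B2_def lin comm)
  note sw' = sandwich_adjoint[OF sw(1), folded C1_def] sandwich_adjoint[OF sw(2), folded C2_def]
  have comm_F: "F1 (F2 s) = F2 (F1 s)" if "s \<in> S" for s
    by (rule sandwich_commute[OF sw BC(1) that])
  have normal_F: "normal_on S F1" "normal_on S F2"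
    using F(1,2) sandwich_commute[OF sw(1) sw'(1) BC(2)] sandwich_commute[OF sw(2) sw'(2) BC(3)]
    by (simp_all add: normal_on_def)

  have num: "cmod (cinner (F1 s) s) + cmod (cinner (F2 s) s) \<le> (norm s)\<^sup>2" if "s \<in> S" for s
    using tetrablock_contraction_numerical_range[OF X]
    by (intro sandwich_numerical_range[OF sw _ that]) (simp add: D(4) B1_def B2_def A1_def A2_def)
  have "opnorm_on S (\<lambda>x. adjoint_on S F1 x + z *\<^sub>C F2 x) \<le> 1" if "cmod z \<le> 1" for z
    unfolding opnorm_on_def
  proof (rule cSUP_least)
    show "{x \<in> S. norm x \<le> 1} \<noteq> {}"
      using closed_csubspaceD(2)[OF S] by auto
    show "norm (adjoint_on S F1 x + z *\<^sub>C F2 x) \<le> 1" if "x \<in> {x \<in> S. norm x \<le> 1}" for x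
      using norm_adjoint_plus_scaleC_le[OF S normal_F comm_F num \<open>cmod z \<le> 1\<close>, of x] that by simp
  qed
  then have "(SUP z\<in>cball (0::complex) 1. opnorm_on S (\<lambda>x. adjoint_on S F1 x + z *\<^sub>C F2 x)) \<le> 1"
    by (intro cSUP_least) auto
  then show ?thesis
    unfolding S_eq commute_on_def using normal_F comm_F by simp
qed

end
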